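(* Let $\mathcal{F}=(\mathcal{X}_n,K_n,\pi_n)_{n=1}^\infty$ be a family of irreducible Markov chains on countable state spaces, $\mathcal{P}=(p_n)_{n=1}^\infty$ a sequence of positive reals, and $\mathcal{F}^{\mathcal{P}}$ the family whose $n$th chain is the product of $(\mathcal{X}_i,K_i,\pi_i)_{i=1}^n$ according to the probability vector $(p_1/q_n,\dots,p_n/q_n)$, $q_n=p_1+\cdots+p_n$. Let $T^{(c)}_{n,\mathrm{TV}}$ be the maximum total variation mixing time of the $n$th chain in $\mathcal{F}_c$. Let $\epsilon_n$ be a sequence satisfying $0<\inf_n\epsilon_n\le\sup_n\epsilon_n<1/2$ and write $$D_n:=\log\frac{T^{(c)}_{n,\mathrm{TV}}(\epsilon_n)}{p_n}=A_nn+B_n+C_n .$$ Assume that: (I) either $0<A_n\le A_{n+1}$ for all $n$, or $n|A_n-A|$ is bounded for some $A>0$; (II) $B_n$ is nondecreasing, $C_n$ is bounded and $D_n$ is nondecreasing for $n$ large enough. Then, in the total variation: (1) If $\mathcal{F}_c$ has a cutoff with cutoff time $t_n$, then $\mathcal{F}^{\mathcal{P}}_c$ has a cutoff with cutoff time $(p_1+\cdots+p_n)t_n/p_n$. (2) If no subfamily of $\mathcal{F}_c$ has a cutoff, then $\mathcal{F}^{\mathcal{P}}_c$ has no cutoff. Similarly for the Hellinger distance: let $T^{(c)}_{n,H}$ be the maximum Hellinger mixing time of the $n$th chain in $\mathcal{F}_c$, let $\epsilon_n$ be a sequence satisfying $0<\inf_n\epsilon_n\le\sup_n\epsilon_n<1/4$,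 write $$D_n:=\log\frac{T^{(c)}_{n,H}(\epsilon_n)}{p_n}=A_nn+B_n+C_n ,$$ and assume that these $A_n,B_n,C_n,D_n$ satisfy (I) and (II). Then, in the Hellinger distance: if $\mathcal{F}_c$ has a cutoff with cutoff time $t_n$, then $\mathcal{F}^{\mathcal{P}}_c$ has a cutoff with cutoff time $(p_1+\cdots+p_n)t_n/p_n$; and if no subfamily of $\mathcal{F}_c$ has a cutoff, then $\mathcal{F}^{\mathcal{P}}_c$ has no cutoff.
   Context: A Markov chain $(\mathcal{X},K,\pi)$ has countable state space $\mathcal{X}$, irreducible stochastic matrix $K$ and stationary distribution $\pi$; its associated continuous time chain is $(\mathcal{X},H_t,\pi)$ with $H_t=e^{-t(I-K)}$. A subscript $c$ on a family denotes the family of associated continuous time chains. Distances: $d^{(c)}_{\mathrm{TV}}(t)=\sup_{x\in\mathcal{X},A\subset\mathcal{X}}\{H_t(x,A)-\pi(A)\}$, $d^{(c)}_H(t)=\sup_{x}\big(\frac12\sum_{y}(\sqrt{H_t(x,y)}-\sqrt{\pi(y)})^2\big)^{1/2}$; mixing times $T^{(c)}_*(\epsilon)=\inf\{t\ge0:d^{(c)}_*(t)\le\epsilon\}$, $*\in\{\mathrm{TV},H\}$. Product chain of $(\mathcal{X}_i,K_i,\pi_i)_{i=1}^n$ according to a probability vector $(w_1,\dots,w_n)$ with positive entries: state space $\prod_i\mathcal{X}_i$, stationary distribution $\pi_1\times\cdots\times\pi_n$, transition matrix $\sum_{i=1}^nw_i\,I_1\otimes\cdots\otimes I_{i-1}\otimes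 K_i\otimes I_{i+1}\otimes\cdots\otimes I_n$. A family of continuous time chains with distances $d_n(t)$ has a cutoff with cutoff time $t_n>0$ if $d_n(at_n)\to0$ for all $a>1$ and $d_n(at_n)\to1$ for all $a\in(0,1)$ as $n\to\infty$; it has a cutoff if such $t_n$ exists. A subfamily of $\mathcal{F}$ is $(\mathcal{X}_{\xi_n},K_{\xi_n},\pi_{\xi_n})_{n=1}^\infty$ with $(\xi_n)$ an increasing sequence of positive integers (similarly for $\mathcal{F}_c$). *)

theory Defs
  imports "HOL-Analysis.Analysis"
begin

text \<open>A matrix indexed by a set \<open>S\<close> is a function of two arguments of which only the values on
  \<open>S \<times> S\<close> matter; all sums over states are taken over \<open>S\<close>.\<close>

definition id_mat :: "'a \<Rightarrow> 'a \<Rightarrow> real" where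
  "id_mat x y = (if x = y then 1 else 0)"

fun mat_pow :: "'a set \<Rightarrow> ('a \<Rightarrow> 'a \<Rightarrow> real) \<Rightarrow> nat \<Rightarrow> 'a \<Rightarrow> 'a \<Rightarrow> real" where
  "mat_pow S M 0 x y = id_mat x y"
| "mat_pow S M (Suc m) x y = (\<Sum>\<^sub>\<infinity>z\<in>S. M x z * mat_pow S M m z y)"

definition mat_exp :: "'a set \<Rightarrow> ('a \<Rightarrow> 'a \<Rightarrow> real) \<Rightarrow> 'a \<Rightarrow> 'a \<Rightarrow> real" where
  "mat_exp S M x y = (\<Sum>m. mat_pow S M m x y / fact m)"

record 'a chain =
  states :: "'a set"
  kernel :: "'a \<Rightarrow> 'a \<Rightarrow> real"
  stationary :: "'a \<Rightarrow> real"

definition stochastic :: "'a set \<Rightarrow> ('a \<Rightarrow> 'a \<Rightarrow> real) \<Rightarrow> bool" where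
  "stochastic S K \<longleftrightarrow>
     (\<forall>x\<in>S. (\<forall>y\<in>S. 0 \<le> K x y) \<and> ((\<lambda>y. K x y) has_sum 1) S)"

definition irreducible_mat :: "'a set \<Rightarrow> ('a \<Rightarrow> 'a \<Rightarrow> real) \<Rightarrow> bool" where
  "irreducible_mat S K \<longleftrightarrow> (\<forall>x\<in>S. \<forall>y\<in>S. \<exists>m. 0 < mat_pow S K m x y)"

definition stationary_distribution ::
    "'a set \<Rightarrow> ('a \<Rightarrow> 'a \<Rightarrow> real) \<Rightarrow> ('a \<Rightarrow> real) \<Rightarrow> bool" where
  "stationary_distribution S K \<pi> \<longleftrightarrow>
     (\<forall>x\<in>S. 0 \<le> \<pi> x) \<and> (\<pi> has_sum 1) S \<and>
     (\<forall>y\<in>S. ((\<lambda>x. \<pi> x * K x y) has_sum \<pi> y) S)"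

definition irreducible_chain :: "'a chain \<Rightarrow> bool" where
  "irreducible_chain M \<longleftrightarrow>
     countable (states M) \<and> stochastic (states M) (kernel M) \<and>
     irreducible_mat (states M) (kernel M) \<and>
     stationary_distribution (states M) (kernel M) (stationary M)"

definition transition_semigroup :: "'a chain \<Rightarrow> real \<Rightarrow> 'a \<Rightarrow> 'a \<Rightarrow> real" where
  "transition_semigroup M t = mat_exp (states M) (\<lambda>x y. - t * (id_mat x y - kernel M x y))"

text \<open>Both suprema below are over nonempty sets bounded by 1 when \<open>M\<close> is a Markov chain
  and \<open>t \<ge> 0\<close>.\<close>

definition tv_dist :: "'a chain \<Rightarrow> real \<Rightarrow> real" where
  "tv_dist M t = (SUP (x, A) \<in> states M \<times> Pow (states M).
     (\<Sum>\<^sub>\<infinity>y\<in>A. transition_semigroup M t x y) - (\<Sum>\<^sub>\<infinity>y\<in>A. stationary M y))"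

definition hellinger_dist :: "'a chain \<Rightarrow> real \<Rightarrow> real" where
  "hellinger_dist M t = (SUP x \<in> states M.
     sqrt (1 / 2 * (\<Sum>\<^sub>\<infinity>y\<in>states M. (sqrt (transition_semigroup M t x y) - sqrt (stationary M y))\<^sup>2)))"

text \<open>The mixing time is infinite if the distance never drops to \<open>\<epsilon>\<close>, which can happen on
  infinite state spaces.\<close>

definition mixing_time :: "(real \<Rightarrow> real) \<Rightarrow> real \<Rightarrow> ereal" where
  "mixing_time d \<epsilon> = (INF t \<in> {t. 0 \<le> t \<and> d t \<le> \<epsilon>}. ereal t)"

text \<open>Families and sequences are indexed by the positive integers; their values at 0 are
  never used.\<close>

definition product_chain :: "nat \<Rightarrow> (nat \<Rightarrow> real) \<Rightarrow> (nat \<Rightarrow> 'a chain) \<Rightarrow> (nat \<Rightarrow> 'a) chain" where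
  "product_chain n w F =
     \<lparr> states = (\<Pi>\<^sub>E i\<in>{1..n}. states (F i)),
       kernel = (\<lambda>x y. \<Sum>i=1..n. w i *
         (\<Prod>j=1..n. (if j = i then kernel (F j) else id_mat) (x j) (y j))),
       stationary = (\<lambda>x. \<Prod>i=1..n. stationary (F i) (x i)) \<rparr>"

definition product_family :: "(nat \<Rightarrow> real) \<Rightarrow> (nat \<Rightarrow> 'a chain) \<Rightarrow> nat \<Rightarrow> (nat \<Rightarrow> 'a) chain" where
  "product_family p F n = product_chain n (\<lambda>i. p i / (\<Sum>j=1..n. p j)) F"

text \<open>Here \<open>d n\<close> is the distance function of the \<open>n\<close>-th continuous time chain.\<close>

definition has_cutoff_time :: "(nat \<Rightarrow> real \<Rightarrow> real) \<Rightarrow> (nat \<Rightarrow> real) \<Rightarrow> bool" where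
  "has_cutoff_time d t \<longleftrightarrow>
     (\<forall>n\<ge>1. 0 < t n) \<and>
     (\<forall>a>1. (\<lambda>n. d n (a * t n)) \<longlonglongrightarrow> 0) \<and>
     (\<forall>a. 0 < a \<and> a < 1 \<longrightarrow> (\<lambda>n. d n (a * t n)) \<longlonglongrightarrow> 1)"

definition has_cutoff :: "(nat \<Rightarrow> real \<Rightarrow> real) \<Rightarrow> bool" where
  "has_cutoff d \<longleftrightarrow> (\<exists>t. has_cutoff_time d t)"

definition some_subfamily_has_cutoff :: "(nat \<Rightarrow> real \<Rightarrow> real) \<Rightarrow> bool" where
  "some_subfamily_has_cutoff d \<longleftrightarrow>
     (\<exists>\<xi>. strict_mono_on {1..} \<xi> \<and> (\<forall>n\<ge>1. 1 \<le> \<xi> n) \<and> has_cutoff (\<lambda>n. d (\<xi> n)))"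

text \<open>The positivity and finiteness of the mixing times are what makes
  \<open>ln (T\<^sub>n(\<epsilon>\<^sub>n) / p\<^sub>n)\<close> a real number.\<close>

definition log_mixing_decomposition ::
    "(nat \<Rightarrow> real \<Rightarrow> real) \<Rightarrow> (nat \<Rightarrow> real) \<Rightarrow> (nat \<Rightarrow> real) \<Rightarrow>
     (nat \<Rightarrow> real) \<Rightarrow> (nat \<Rightarrow> real) \<Rightarrow> (nat \<Rightarrow> real) \<Rightarrow> (nat \<Rightarrow> real) \<Rightarrow> bool" where
  "log_mixing_decomposition d p \<epsilon> D A B C \<longleftrightarrow>
     (\<forall>n\<ge>1. 0 < mixing_time (d n) (\<epsilon> n) \<and> mixing_time (d n) (\<epsilon> n) < \<infinity> \<and>
            D n = ln (real_of_ereal (mixing_time (d n) (\<epsilon> n)) / p n) \<and>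
            D n = A n * real n + B n + C n)"

definition condition_I :: "(nat \<Rightarrow> real) \<Rightarrow> bool" where
  "condition_I A \<longleftrightarrow>
     (\<forall>n\<ge>1. 0 < A n \<and> A n \<le> A (Suc n)) \<or>
     (\<exists>a>0. bounded ((\<lambda>n. real n * \<bar>A n - a\<bar>) ` {1..}))"

definition condition_II :: "(nat \<Rightarrow> real) \<Rightarrow> (nat \<Rightarrow> real) \<Rightarrow> (nat \<Rightarrow> real) \<Rightarrow> bool" where
  "condition_II B C D \<longleftrightarrow>
     mono_on {1..} B \<and> bounded (C ` {1..}) \<and> (\<exists>N. mono_on {N..} D)"

end

theory Submission
  imports Defs
begin

text \<open>
  Both distances are governed by an overlap of probability vectors. For a function \<open>\<phi>\<close> of two
  nonnegative reals put \<open>affinity \<phi> S \<mu> \<nu> = \<Sum>y. \<phi> (\<mu> y) (\<nu> y)\<close>, and let \<open>worst_gap \<phi> M t\<close> be the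
  supremum over the starting states of one minus the affinity of the law at time \<open>t\<close> with the
  stationary law. For \<open>\<phi> = min\<close> this is the total variation distance, for the geometric mean it is
  the square of the Hellinger distance. Since \<open>\<phi>\<close> is homogeneous and superadditive, affinities grow
  under stochastic matrices; so the gap decreases in time, and the gap of a product chain is at least
  that of each factor (forget the other coordinates). Since \<open>\<phi>\<close> is supermultiplicative, the gap of a
  product is at most \<open>1 - (\<Prod>i. 1 - d i)\<close>, where the \<open>d i\<close> are the gaps of the factors. Both facts
  need that the semigroup of the product chain factorizes, the \<open>i\<close>-th factor being run at speed
  \<open>w i\<close>; this holds because both sides solve the same Kolmogorov backward equation, whose bounded
  solutions are determined by their initial value.

  Measure time so that factor \<open>i\<close> is run at speed \<open>p i\<close>. Its mixing time becomes
  \<open>E i = exp (D i)\<close>. The total variation distance satisfies \<open>2 d (s + t) \<le> (2 d s) (2 d t)\<close>, and at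
  a time after \<open>E i\<close> the quantity \<open>2 d\<close> is below some \<open>r < 1\<close> by the bound on \<open>\<epsilon>\<close>. Hence the gap of
  factor \<open>i\<close> decays geometrically on the scale \<open>E i\<close>; it suffices to know that at time \<open>s\<close> it is at
  most a constant times \<open>E i / s\<close>. The assumptions on \<open>A\<close>, \<open>B\<close>, \<open>C\<close> make \<open>E i / E n\<close> at most a
  constant times \<open>\<rho> ^ (n - i)\<close> with \<open>\<rho> < 1\<close>. So at times comparable to \<open>E n\<close> only the last few
  factors of the \<open>n\<close>-th product contribute.

  If the factors have a cutoff at times \<open>u n\<close>, then \<open>u n / E n\<close> tends to \<open>1\<close>. As \<open>E\<close> is
  eventually monotone, for \<open>a > 1\<close> each of the last factors is past its own cutoff at time \<open>a * u n\<close>,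
  and the product gap, bounded by the sum of the factor gaps, tends to \<open>0\<close> by dominated convergence.
  For \<open>a < 1\<close> the last factor alone keeps the product gap near \<open>1\<close>
  (\<open>cutoff_transfers_to_products\<close>). Conversely, let the products have a cutoff at times \<open>u n\<close>. At
  time \<open>a * u n\<close> with \<open>a < 1\<close> the product \<open>\<Prod>i. 1 - d i\<close> tends to \<open>0\<close>, while its factors with
  \<open>i\<close> far from \<open>n\<close> contribute at least \<open>1/2\<close>; so one of boundedly many factors near \<open>n\<close> has a gap
  near \<open>1\<close>. For \<open>a > 1\<close> all gaps are near \<open>0\<close>. Letting \<open>a\<close> tend to \<open>1\<close> along a sparse sequence of
  \<open>n\<close> selects a subfamily with a cutoff (\<open>product_cutoff_imp_subfamily_cutoff\<close>).
\<close>

section \<open>Infinite sums of nonnegative terms\<close>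

text \<open>Tonelli's theorem in the form used throughout: rows, row total and columns are given by their values.\<close>

lemma has_sum_swap_nonneg:
  fixes f :: "'b \<Rightarrow> 'c \<Rightarrow> real"
  assumes nonneg: "\<And>x y. x \<in> A \<Longrightarrow> y \<in> B \<Longrightarrow> 0 \<le> f x y"
    and rows: "\<And>x. x \<in> A \<Longrightarrow> (f x has_sum g x) B"
    and total: "(g has_sum s) A"
    and columns: "\<And>y. y \<in> B \<Longrightarrow> ((\<lambda>x. f x y) has_sum h y) A"
  shows "(h has_sum s) B"
proof -
  have "(\<lambda>(x, y). f x y) summable_on A \<times> B"
    by (rule summable_on_SigmaI[where g = g]) (use nonneg rows total in \<open>auto simp: summable_on_def\<close>)
  then have "((\<lambda>(x, y). f x y) has_sum s) (A \<times> B)"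
    by (intro has_sum_SigmaI[where g = g]) (use rows total in auto)
  then have "((\<lambda>(y, x). f x y) has_sum s) (B \<times> A)"
    by (subst (asm) has_sum_swap) (simp add: case_prod_unfold)
  then show ?thesis
    by (rule has_sum_SigmaD) (use columns in auto)
qed

lemma summable_on_column_nonneg:
  fixes f :: "'b \<Rightarrow> 'c \<Rightarrow> real"
  assumes nonneg: "\<And>x y. x \<in> A \<Longrightarrow> y \<in> B \<Longrightarrow> 0 \<le> f x y"
    and rows: "\<And>x. x \<in> A \<Longrightarrow> (f x has_sum g x) B"
    and total: "(g has_sum s) A" and y: "y \<in> B"
  shows "(\<lambda>x. f x y) summable_on A"
proof (rule summable_on_comparison_test)
  show "g summable_on A" using total by (auto simp: summable_on_def)
  fix x assume x: "x \<in> A"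
  have "((\<lambda>z. f x z) has_sum f x y) {y}" 
    by (metis has_sum_finite_iff[of "{y}" "f x"] finite.emptyI finite_insert sum.insert_if sum.empty add_0_right empty_iff)
  from has_sum_mono2[OF this rows[OF x]] show "f x y \<le> g x" using nonneg x y by auto
qed (use nonneg y in auto)

text \<open>The corresponding infsum formula says nothing about summability on the product set. For nonnegative
  factors it can be recovered from it: a nonzero infsum forces summability, and if the value is zero
  then some factor vanishes identically.\<close>

lemma has_sum_prod_PiE:
  fixes f :: "'i \<Rightarrow> 'b \<Rightarrow> real"
  assumes fin: "finite A"
    and nonneg: "\<And>i z. i \<in> A \<Longrightarrow> z \<in> B i \<Longrightarrow> 0 \<le> f i z"
    and sums: "\<And>i. i \<in> A \<Longrightarrow> (f i has_sum s i) (B i)"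
  shows "((\<lambda>g. \<Prod>i\<in>A. f i (g i)) has_sum (\<Prod>i\<in>A. s i)) (PiE A B)"
proof -
  have inf: "infsum (\<lambda>g. \<Prod>i\<in>A. f i (g i)) (PiE A B) = (\<Prod>i\<in>A. infsum (f i) (B i))"
  proof (rule infsum_prod_PiE_abs[OF fin])
    fix i assume i: "i \<in> A"
    then have "f i summable_on B i" using sums by (auto simp: summable_on_def)
    then show "(\<lambda>z. norm (f i z)) summable_on B i"
      by (rule summable_on_cong[THEN iffD1, rotated]) (use nonneg i in auto)
  qed
  have eq: "(\<Prod>i\<in>A. infsum (f i) (B i)) = (\<Prod>i\<in>A. s i)"
    by (rule prod.cong) (use sums in \<open>auto simp: infsumI\<close>)
  have "(\<lambda>g. \<Prod>i\<in>A. f i (g i)) summable_on PiE A B"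
  proof (cases "(\<Prod>i\<in>A. s i) = 0")
    case False
    then show ?thesis using inf eq infsum_not_exists by fastforce
  next
    case True
    then obtain i where i: "i \<in> A" "s i = 0" using fin by auto
    \<comment> \<open>A factor of total mass zero vanishes identically, and so does the product.\<close>
    have "f i z = 0" if "z \<in> B i" for z
      using nonneg_has_sum_le_0D[OF sums[OF i(1)]] i nonneg that by auto
    then have "(\<Prod>i\<in>A. f i (g i)) = 0" if "g \<in> PiE A B" for g
      using i fin that by (auto simp: PiE_iff)
    then show ?thesis using summable_on_cong[of "PiE A B" "\<lambda>g. \<Prod>i\<in>A. f i (g i)" "\<lambda>_. 0"] by auto
  qed
  then show ?thesis using inf eq by (simp add: has_sum_infsum has_sum_iff)
qed

lemma has_sum_indicator:
  fixes f :: "'b \<Rightarrow> real"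
  assumes "x \<in> A"
  shows "((\<lambda>y. if y = x then f y else 0) has_sum f x) A"
    and "((\<lambda>y. if x = y then f y else 0) has_sum f x) A"
proof -
  have "((\<lambda>y. if y = x then f y else 0) has_sum f x) {x}"
    using has_sum_finite[of "{x}" "\<lambda>y. if y = x then f y else 0"] by simp
  then show 1: "((\<lambda>y. if y = x then f y else 0) has_sum f x) A"
    by (rule has_sum_cong_neutral[THEN iffD1, rotated -1]) (use assms in auto)
  then show "((\<lambda>y. if x = y then f y else 0) has_sum f x) A" by (simp add: eq_commute[of x])
qed

section \<open>Powers and the exponential of a stochastic matrix\<close>

lemma has_sum_finite_sum:
  fixes f :: "'i \<Rightarrow> 'b \<Rightarrow> real"
  assumes "\<And>i. i \<in> I \<Longrightarrow> (f i has_sum s i) A"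
  shows "((\<lambda>x. \<Sum>i\<in>I. f i x) has_sum (\<Sum>i\<in>I. s i)) A"
  using assms by (induction I rule: infinite_finite_induct) (auto intro!: has_sum_add)

lemma stochasticD:
  assumes "stochastic S K" "x \<in> S"
  shows "y \<in> S \<Longrightarrow> 0 \<le> K x y" and "(K x has_sum 1) S" and "y \<in> S \<Longrightarrow> K x y \<le> 1"
proof -
  show nonneg: "0 \<le> K x y" if "y \<in> S" for y using assms that by (auto simp: stochastic_def)
  show sums: "(K x has_sum 1) S" using assms by (auto simp: stochastic_def)
  show "K x y \<le> 1" if "y \<in> S"
    by (rule has_sum_mono2[OF has_sum_finite[of "{y}" "K x"] sums, simplified]) (use nonneg that in auto)
qed

lemma stochastic_apply:
  fixes f :: "'a \<Rightarrow> real"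
  assumes K: "stochastic S K" "x \<in> S" and f: "\<And>z. z \<in> S \<Longrightarrow> \<bar>f z\<bar> \<le> c"
  shows "((\<lambda>z. K x z * f z) has_sum (\<Sum>\<^sub>\<infinity>z\<in>S. K x z * f z)) S"
    and "\<bar>\<Sum>\<^sub>\<infinity>z\<in>S. K x z * f z\<bar> \<le> c"
proof -
  have le: "\<bar>K x z * f z\<bar> \<le> K x z * c" if "z \<in> S" for z
    using stochasticD(1)[OF K that] f[OF that] by (auto simp: abs_mult intro!: mult_left_mono)
  have c: "((\<lambda>z. K x z * c) has_sum c) S"
    using has_sum_cmult_left[OF stochasticD(2)[OF K], of c] by simp
  then have "(\<lambda>z. norm (K x z * f z)) summable_on S"
    by (intro Infinite_Sum.abs_summable_on_comparison_test'[where g = "\<lambda>z. K x z * c"])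
       (use le in \<open>auto simp: summable_on_def\<close>)
  then have "(\<lambda>z. K x z * f z) summable_on S" by (rule abs_summable_summable)
  then show 1: "((\<lambda>z. K x z * f z) has_sum (\<Sum>\<^sub>\<infinity>z\<in>S. K x z * f z)) S" by simp
  have "(\<Sum>\<^sub>\<infinity>z\<in>S. K x z * f z) \<le> c"
    by (rule has_sum_mono[OF 1 c]) (use le in \<open>force simp: abs_le_iff\<close>)
  moreover have "- c \<le> (\<Sum>\<^sub>\<infinity>z\<in>S. K x z * f z)"
    by (rule has_sum_mono[OF has_sum_cmult_right[OF c, of "-1", simplified] 1])
       (use le in \<open>force simp: abs_le_iff\<close>)
  ultimately show "\<bar>\<Sum>\<^sub>\<infinity>z\<in>S. K x z * f z\<bar> \<le> c" by linarith
qed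

lemma stochastic_mat_pow:
  assumes K: "stochastic S K"
  shows "stochastic S (mat_pow S K m)"
proof (induction m)
  case 0
  show ?case
    using has_sum_indicator(2)[of _ S "\<lambda>_. 1"] by (auto simp: stochastic_def id_mat_def)
next
  case (Suc m)
  note P = stochasticD[OF Suc]
  have step: "((\<lambda>z. K x z * mat_pow S K m z y) has_sum mat_pow S K (Suc m) x y) S"
    if "x \<in> S" "y \<in> S" for x y
    using stochastic_apply(1)[OF K, of x "\<lambda>z. mat_pow S K m z y" 1] P that by simp
  have "(mat_pow S K (Suc m) x has_sum 1) S" if x: "x \<in> S" for x
  proof (rule has_sum_swap_nonneg)
    show "((\<lambda>y. K x z * mat_pow S K m z y) has_sum K x z) S" if "z \<in> S" for z
      using has_sum_cmult_right[OF P(2)[OF that], of "K x z"] by simp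
  qed (use step x stochasticD[OF K x] P in auto)
  moreover have "0 \<le> mat_pow S K (Suc m) x y" if "x \<in> S" "y \<in> S" for x y
    by (rule has_sum_nonneg[OF step[OF that]]) (use stochasticD[OF K] P that in auto)
  ultimately show ?case unfolding stochastic_def by blast
qed

lemma mat_pow_Suc_has_sum:
  assumes K: "stochastic S K" and "x \<in> S" "y \<in> S"
  shows "((\<lambda>z. K x z * mat_pow S K m z y) has_sum mat_pow S K (Suc m) x y) S"
  using stochastic_apply(1)[OF K, of x "\<lambda>z. mat_pow S K m z y" 1]
    stochasticD[OF stochastic_mat_pow[OF K, of m]] assms by simp

lemma mat_pow_add_has_sum:
  assumes K: "stochastic S K" and x: "x \<in> S" and y: "y \<in> S"
  shows "((\<lambda>z. mat_pow S K m x z * mat_pow S K l z y) has_sum mat_pow S K (m + l) x y) S"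
  using x
proof (induction m arbitrary: x)
  case 0
  have "id_mat x z * q = (if x = z then q else 0)" for z and q :: real by (simp add: id_mat_def)
  then show ?case
    using has_sum_indicator(2)[OF 0, of "\<lambda>z. mat_pow S K l z y"] by simp
next
  case (Suc m)
  note P = stochasticD[OF stochastic_mat_pow[OF K]]
  show ?case
  proof (rule has_sum_swap_nonneg[where A = S])
    show "((\<lambda>z. K x u * (mat_pow S K m u z * mat_pow S K l z y)) has_sum
        K x u * mat_pow S K (m + l) u y) S" if "u \<in> S" for u
      by (rule has_sum_cmult_right[OF Suc.IH[OF that]])
    show "((\<lambda>u. K x u * mat_pow S K (m + l) u y) has_sum mat_pow S K (Suc m + l) x y) S"
      using mat_pow_Suc_has_sum[OF K Suc.prems y] by simp
    show "((\<lambda>u. K x u * (mat_pow S K m u z * mat_pow S K l z y)) has_sum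
        mat_pow S K (Suc m) x z * mat_pow S K l z y) S" if "z \<in> S" for z
      using has_sum_cmult_left[OF mat_pow_Suc_has_sum[OF K Suc.prems that]]
      by (simp add: mult.assoc)
  qed (use stochasticD[OF K] Suc.prems P y in auto)
qed

lemma mat_pow_stationary:
  assumes K: "stochastic S K" and st: "stationary_distribution S K \<pi>" and y: "y \<in> S"
  shows "((\<lambda>x. \<pi> x * mat_pow S K m x y) has_sum \<pi> y) S"
  using y
proof (induction m arbitrary: y)
  case 0
  have "q * id_mat x y = (if x = y then q else 0)" for x and q :: real by (simp add: id_mat_def)
  then show ?case using has_sum_indicator(1)[OF 0, of \<pi>] by simp
next
  case (Suc m)
  note P = stochasticD[OF stochastic_mat_pow[OF K]]
  have \<pi>: "\<And>x. x \<in> S \<Longrightarrow> 0 \<le> \<pi> x" "\<And>y. y \<in> S \<Longrightarrow> ((\<lambda>x. \<pi> x * K x y) has_sum \<pi> y) S"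
    using st by (auto simp: stationary_distribution_def)
  show ?case
  proof (rule has_sum_swap_nonneg[where A = S])
    show "((\<lambda>x. \<pi> x * (K x u * mat_pow S K m u y)) has_sum \<pi> u * mat_pow S K m u y) S" if "u \<in> S" for u
      using has_sum_cmult_left[OF \<pi>(2)[OF that]] by (simp add: mult.assoc)
    show "((\<lambda>u. \<pi> x * (K x u * mat_pow S K m u y)) has_sum \<pi> x * mat_pow S K (Suc m) x y) S"
      if "x \<in> S" for x
      by (rule has_sum_cmult_right[OF mat_pow_Suc_has_sum[OF K that Suc.prems]])
  qed (use stochasticD[OF K] Suc \<pi> P in auto)
qed

text \<open>The matrix \<open>e^(t K)\<close>. It is convenient because all its coefficients are nonnegative for \<open>t \<ge> 0\<close>, in
  contrast to those of the series defining \<open>e^(- t (I - K))\<close>.\<close>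

definition exp_mat :: "'a set \<Rightarrow> ('a \<Rightarrow> 'a \<Rightarrow> real) \<Rightarrow> real \<Rightarrow> 'a \<Rightarrow> 'a \<Rightarrow> real" where
  "exp_mat S K t x y = (\<Sum>m. mat_pow S K m x y / fact m * t ^ m)"

lemma exp_sums: "(\<lambda>m. t ^ m / fact m) sums exp (t :: real)"
  using exp_converges[of t] by (simp add: scaleR_conv_of_real field_simps)

lemma exp_mat_abs_summable:
  assumes K: "stochastic S K" and "x \<in> S" "y \<in> S"
  shows "summable (\<lambda>m. \<bar>mat_pow S K m x y / fact m * t ^ m\<bar>)"
proof (rule summable_comparison_test')
  show "summable (\<lambda>m. \<bar>t\<bar> ^ m / fact m)" using exp_sums sums_summable by blast
  fix m :: nat
  show "norm \<bar>mat_pow S K m x y / fact m * t ^ m\<bar> \<le> \<bar>t\<bar> ^ m / fact m"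
    using stochasticD[OF stochastic_mat_pow[OF K, of m]] assms
    by (auto simp: abs_mult power_abs divide_simps intro!: mult_left_le_one_le)
qed

lemma exp_mat_has_sum:
  assumes K: "stochastic S K" and "x \<in> S" "y \<in> S" and "0 \<le> t"
  shows "((\<lambda>m. mat_pow S K m x y / fact m * t ^ m) has_sum exp_mat S K t x y) UNIV"
  unfolding exp_mat_def
  by (rule sums_nonneg_imp_has_sum, rule summable_sums, rule summable_rabs_cancel,
      rule exp_mat_abs_summable)
     (use stochasticD[OF stochastic_mat_pow[OF K]] assms in auto)

lemma exp_has_sum: "0 \<le> t \<Longrightarrow> ((\<lambda>m. t ^ m / fact m) has_sum exp (t :: real)) UNIV"
  by (rule sums_nonneg_imp_has_sum[OF exp_sums]) auto

lemma exp_mat_nonneg: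
  assumes "stochastic S K" "x \<in> S" "y \<in> S" "0 \<le> t"
  shows "0 \<le> exp_mat S K t x y"
  by (rule has_sum_nonneg[OF exp_mat_has_sum[OF assms]])
     (use stochasticD[OF stochastic_mat_pow[OF assms(1)]] assms in auto)

lemma exp_mat_row_sum:
  assumes K: "stochastic S K" and x: "x \<in> S" and t: "0 \<le> t"
  shows "(exp_mat S K t x has_sum exp t) S"
proof (rule has_sum_swap_nonneg)
  note P = stochasticD[OF stochastic_mat_pow[OF K]]
  show "((\<lambda>y. mat_pow S K m x y / fact m * t ^ m) has_sum t ^ m / fact m) S" for m
    using has_sum_cmult_left[OF P(2)[OF x], where c = "t ^ m / fact m"] by simp
qed (use exp_has_sum[OF t] exp_mat_has_sum[OF K x _ t] 
      stochasticD[OF stochastic_mat_pow[OF K]] x t in auto)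

lemma exp_mat_stationary:
  assumes K: "stochastic S K" and st: "stationary_distribution S K \<pi>" and y: "y \<in> S" and t: "0 \<le> t"
  shows "((\<lambda>x. \<pi> x * exp_mat S K t x y) has_sum (\<pi> y * exp t)) S"
proof (rule has_sum_swap_nonneg)
  note P = stochasticD[OF stochastic_mat_pow[OF K]]
  have \<pi>: "\<And>x. x \<in> S \<Longrightarrow> 0 \<le> \<pi> x" using st by (auto simp: stationary_distribution_def)
  show "((\<lambda>x. \<pi> x * (mat_pow S K m x y / fact m * t ^ m)) has_sum \<pi> y * (t ^ m / fact m)) S" for m
    using has_sum_cmult_left[OF mat_pow_stationary[OF K st y, of m], where c = "t ^ m / fact m"]
    by (simp add: mult_ac)
  show "((\<lambda>m. \<pi> y * (t ^ m / fact m)) has_sum \<pi> y * exp t) UNIV"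
    by (rule has_sum_cmult_right[OF exp_has_sum[OF t]])
  show "((\<lambda>m. \<pi> x * (mat_pow S K m x y / fact m * t ^ m)) has_sum \<pi> x * exp_mat S K t x y) UNIV"
    if "x \<in> S" for x
    by (rule has_sum_cmult_right[OF exp_mat_has_sum[OF K that y t]])
  show "0 \<le> \<pi> x * (mat_pow S K m x y / fact m * t ^ m)" if "x \<in> S" for x m
    using \<pi> P that y t by auto
qed

lemma exp_mat_derivative:
  assumes K: "stochastic S K" and x: "x \<in> S" and y: "y \<in> S" and t: "0 \<le> t"
  shows "((\<lambda>t. exp_mat S K t x y) has_real_derivative (\<Sum>\<^sub>\<infinity>z\<in>S. K x z * exp_mat S K t z y)) (at t)"
proof -
  note P = stochasticD[OF stochastic_mat_pow[OF K]]
  define c where "c m = mat_pow S K m x y / fact m" for m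
  have diffs: "diffs c m = mat_pow S K (Suc m) x y / fact m" for m
    by (simp add: diffs_def c_def divide_simps del: mat_pow.simps)
  have sm: "summable (\<lambda>m. c m * u ^ m)" for u
    unfolding c_def by (rule summable_rabs_cancel) (rule exp_mat_abs_summable[OF K x y])
  have "((\<lambda>t. exp_mat S K t x y) has_real_derivative (\<Sum>m. diffs c m * t ^ m)) (at t)"
    unfolding exp_mat_def c_def[symmetric] by (rule termdiffs_strong_converges_everywhere[OF sm])
  moreover have "summable (\<lambda>m. diffs c m * t ^ m)"
    by (rule termdiff_converges_all[OF sm])
  then have "((\<lambda>m. diffs c m * t ^ m) has_sum (\<Sum>m. diffs c m * t ^ m)) UNIV"
    by (intro sums_nonneg_imp_has_sum summable_sums) (use P x y t in \<open>auto simp: diffs simp del: mat_pow.simps\<close>)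
  then have "((\<lambda>z. K x z * exp_mat S K t z y) has_sum (\<Sum>m. diffs c m * t ^ m)) S"
  proof (rule has_sum_swap_nonneg[rotated 2])
    show "((\<lambda>z. K x z * (mat_pow S K m z y / fact m * t ^ m)) has_sum diffs c m * t ^ m) S" for m
      using has_sum_cmult_left[OF mat_pow_Suc_has_sum[OF K x y, of m], where c = "t ^ m / fact m"]
      by (simp add: diffs mult_ac del: mat_pow.simps)
    show "((\<lambda>m. K x z * (mat_pow S K m z y / fact m * t ^ m)) has_sum K x z * exp_mat S K t z y) UNIV"
      if "z \<in> S" for z by (rule has_sum_cmult_right[OF exp_mat_has_sum[OF K that y t]])
    show "0 \<le> K x z * (mat_pow S K m z y / fact m * t ^ m)" if "z \<in> S" for m z
      using stochasticD(1)[OF K x that] P that y t by auto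
  qed
  ultimately show ?thesis by (simp add: infsumI)
qed

text \<open>The semigroup law: expand both exponentials, sum out the intermediate state by
  \<open>mat_pow_add_has_sum\<close>, and collect the double series along antidiagonals. Nonnegativity of all terms
  justifies every exchange of sums.\<close>

lemma exp_mat_add_has_sum:
  assumes K: "stochastic S K" and x: "x \<in> S" and y: "y \<in> S" and s: "0 \<le> s" and t: "0 \<le> t"
  shows "((\<lambda>z. exp_mat S K s x z * exp_mat S K t z y) has_sum exp_mat S K (s + t) x y) S"
proof -
  note P = stochasticD[OF stochastic_mat_pow[OF K]]
  define a b where "a m = s ^ m / fact m" and "b m = t ^ m / fact m" for m
  have ab: "0 \<le> a m" "0 \<le> b m" for m using s t by (auto simp: a_def b_def)
  define f where "f = (\<lambda>(m, l). a m * b l * mat_pow S K (m + l) x y)"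
  have f0: "0 \<le> f p" for p using ab P x y by (auto simp: f_def split: prod.splits)
  \<comment> \<open>The entry at \<open>(x, y)\<close> of \<open>K^m e^(t K)\<close>.\<close>
  define v where "v m = (\<Sum>\<^sub>\<infinity>z\<in>S. mat_pow S K m x z * exp_mat S K t z y)" for m
  have W: "exp_mat S K t z y \<le> exp t" "0 \<le> exp_mat S K t z y" if "z \<in> S" for z
  proof -
    have 0: "0 \<le> exp_mat S K t z y" if "y \<in> S" for y
      by (rule exp_mat_nonneg[OF K \<open>z \<in> S\<close> that t])
    then show "0 \<le> exp_mat S K t z y" using y by blast
    show "exp_mat S K t z y \<le> exp t"
      by (rule has_sum_mono2[OF has_sum_finite[of "{y}" "exp_mat S K t z"] exp_mat_row_sum[OF K \<open>z \<in> S\<close> t], simplified]) 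
         (use 0 y in auto)
  qed
  have v: "((\<lambda>z. mat_pow S K m x z * exp_mat S K t z y) has_sum v m) S" for m
    unfolding v_def by (rule stochastic_apply(1)[OF stochastic_mat_pow[OF K] x, where c = "exp t"]) (use W in auto)
  have v_le: "v m \<le> exp t" "0 \<le> v m" for m
    using stochastic_apply(2)[OF stochastic_mat_pow[OF K] x, where c = "exp t" and f = "\<lambda>z. exp_mat S K t z y" and m1 = m] W
    by (force simp: v_def abs_le_iff) (use has_sum_nonneg[OF v] P x W in auto)
  \<comment> \<open>Row \<open>m\<close> of the double series is \<open>a m * v m\<close>.\<close>
  have row: "((\<lambda>l. f (m, l)) has_sum a m * v m) UNIV" for m
  proof -
    have "((\<lambda>l. b l * mat_pow S K (m + l) x y) has_sum v m) UNIV"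
    proof (rule has_sum_swap_nonneg[OF _ _ v])
      show "((\<lambda>l. mat_pow S K m x z * (mat_pow S K l z y / fact l * t ^ l)) has_sum
          mat_pow S K m x z * exp_mat S K t z y) UNIV" if "z \<in> S" for z
        by (rule has_sum_cmult_right[OF exp_mat_has_sum[OF K that y t]])
      show "((\<lambda>z. mat_pow S K m x z * (mat_pow S K l z y / fact l * t ^ l)) has_sum
          b l * mat_pow S K (m + l) x y) S" for l
        using has_sum_cmult_right[OF mat_pow_add_has_sum[OF K x y, of m l], of "b l"]
        by (simp add: b_def mult_ac)
    qed (use P x y t in auto)
    from has_sum_cmult_right[OF this, of "a m"] show ?thesis by (simp add: f_def mult.assoc)
  qed
  have "(\<lambda>m. a m * v m) summable_on UNIV"
  proof (rule summable_on_comparison_test)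
    show "(\<lambda>m. a m * exp t) summable_on UNIV"
      using has_sum_cmult_left[OF exp_has_sum[OF s]] unfolding a_def summable_on_def by blast
  qed (use ab v_le in \<open>auto intro!: mult_left_mono\<close>)
  then obtain V where V: "((\<lambda>m. a m * v m) has_sum V) UNIV" by (auto simp: summable_on_def)
  have f_sum: "(f has_sum V) (UNIV \<times> UNIV)"
  proof (rule has_sum_SigmaI[OF row V])
    show "f summable_on UNIV \<times> UNIV"
      by (rule summable_on_SigmaI[OF row]) (use V f0 in \<open>auto simp: summable_on_def\<close>)
  qed
  have 1: "((\<lambda>z. exp_mat S K s x z * exp_mat S K t z y) has_sum V) S"
  proof (rule has_sum_swap_nonneg[OF _ _ V])
    show "((\<lambda>z. a m * (mat_pow S K m x z * exp_mat S K t z y)) has_sum a m * v m) S" for m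
      by (rule has_sum_cmult_right[OF v])
    show "((\<lambda>m. a m * (mat_pow S K m x z * exp_mat S K t z y)) has_sum
        exp_mat S K s x z * exp_mat S K t z y) UNIV" if "z \<in> S" for z
      using has_sum_cmult_left[OF exp_mat_has_sum[OF K x that s], of "exp_mat S K t z y"]
      by (simp add: a_def mult_ac)
  qed (use ab P x W in auto)
  \<comment> \<open>Summing along the antidiagonals gives the exponential series of \<open>s + t\<close>.\<close>
  have "((\<lambda>(n, k). f (k, n - k)) has_sum V) (SIGMA n:UNIV. {..n})"
    by (rule has_sum_reindex_bij_witness[where i = "\<lambda>(m, l). (m + l, m)" and j = "\<lambda>(n, k). (k, n - k)",
          THEN iffD2, OF _ _ _ _ _ _ f_sum]) auto
  then have "((\<lambda>n. \<Sum>k\<le>n. f (k, n - k)) has_sum V) UNIV"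
    by (rule has_sum_SigmaD) (auto intro!: has_sum_finite)
  moreover have "(\<Sum>k\<le>n. f (k, n - k)) = mat_pow S K n x y / fact n * (s + t) ^ n" for n
  proof -
    have "(s + t) ^ n / fact n = (\<Sum>k\<le>n. a k * b (n - k))"
      by (simp add: binomial_ring sum_divide_distrib a_def b_def binomial_fact)
    moreover have "(\<Sum>k\<le>n. f (k, n - k)) = (\<Sum>k\<le>n. a k * b (n - k)) * mat_pow S K n x y"
      by (simp add: f_def sum_distrib_right)
    ultimately show ?thesis by (metis mult.commute times_divide_eq_left)
  qed
  ultimately have "((\<lambda>n. mat_pow S K n x y / fact n * (s + t) ^ n) has_sum V) UNIV" by simp
  then have "V = exp_mat S K (s + t) x y"
    using exp_mat_has_sum[OF K x y, of "s + t"] s t has_sum_unique by fastforce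
  with 1 show ?thesis by simp
qed

section \<open>The continuous time semigroup\<close>

text \<open>Pascal's rule for the binomial formula in which the powers of \<open>b\<close> are accompanied by a sequence \<open>q\<close>;
  below, \<open>q j\<close> is an entry of the \<open>j\<close>-th power of the kernel.\<close>

lemma binomial_sum_Suc:
  fixes a b :: real
  shows "(\<Sum>j\<le>Suc m. real (Suc m choose j) * a ^ (Suc m - j) * b ^ j * q j)
    = a * (\<Sum>j\<le>m. real (m choose j) * a ^ (m - j) * b ^ j * q j)
      + b * (\<Sum>j\<le>m. real (m choose j) * a ^ (m - j) * b ^ j * q (Suc j))"
proof -
  have "a * (\<Sum>j\<le>m. real (m choose j) * a ^ (m - j) * b ^ j * q j)
      = (\<Sum>j\<le>m. real (m choose j) * a ^ (Suc m - j) * b ^ j * q j)"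
    by (simp add: sum_distrib_left Suc_diff_le mult_ac)
  also have "\<dots> = (\<Sum>j\<le>Suc m. real (m choose j) * a ^ (Suc m - j) * b ^ j * q j)" by simp
  also have "\<dots> = a ^ Suc m * q 0 + (\<Sum>j\<le>m. real (m choose Suc j) * a ^ (m - j) * b ^ Suc j * q (Suc j))"
    by (subst sum.atMost_Suc_shift) simp
  finally show ?thesis
    by (subst sum.atMost_Suc_shift)
       (simp add: algebra_simps sum.distrib sum_distrib_left)
qed

text \<open>The identity matrix commutes with \<open>K\<close>, so powers of \<open>- t (I - K)\<close> obey the binomial formula.\<close>

lemma mat_pow_generator:
  assumes K: "stochastic S K" and x: "x \<in> S" and y: "y \<in> S"
  shows "mat_pow S (\<lambda>x y. - t * (id_mat x y - K x y)) m x y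
    = (\<Sum>j\<le>m. real (m choose j) * (- t) ^ (m - j) * t ^ j * mat_pow S K j x y)"
  using x
proof (induction m arbitrary: x)
  case 0
  then show ?case by simp
next
  case (Suc m)
  define c where "c j = real (m choose j) * (- t) ^ (m - j) * t ^ j" for j
  define q where "q z = (\<Sum>j\<le>m. c j * mat_pow S K j z y)" for z
  have "((\<lambda>z. K x z * q z) has_sum (\<Sum>j\<le>m. c j * mat_pow S K (Suc j) x y)) S"
  proof -
    have "((\<lambda>z. \<Sum>j\<le>m. c j * (K x z * mat_pow S K j z y)) has_sum (\<Sum>j\<le>m. c j * mat_pow S K (Suc j) x y)) S"
      by (intro has_sum_finite_sum has_sum_cmult_right mat_pow_Suc_has_sum[OF K Suc.prems y])
    then show ?thesis by (simp add: q_def sum_distrib_left mult_ac)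
  qed
  moreover have "((\<lambda>z. id_mat x z * q z) has_sum q x) S"
  proof -
    have "id_mat x z * q z = (if x = z then q z else 0)" for z by (simp add: id_mat_def)
    then show ?thesis using has_sum_indicator(2)[OF Suc.prems, of q] by simp
  qed
  ultimately have "((\<lambda>z. (- t) * (id_mat x z * q z) + t * (K x z * q z)) has_sum
      (- t) * q x + t * (\<Sum>j\<le>m. c j * mat_pow S K (Suc j) x y)) S"
    by (intro has_sum_add has_sum_cmult_right)
  then have "((\<lambda>z. - t * (id_mat x z - K x z) * q z) has_sum
      (- t) * q x + t * (\<Sum>j\<le>m. c j * mat_pow S K (Suc j) x y)) S"
    by (simp add: algebra_simps)
  then have "mat_pow S (\<lambda>x y. - t * (id_mat x y - K x y)) (Suc m) x y
      = (- t) * q x + t * (\<Sum>j\<le>m. c j * mat_pow S K (Suc j) x y)"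
    using Suc.IH by (auto simp: q_def c_def intro!: infsumI cong: infsum_cong)
  then show ?case by (simp only: binomial_sum_Suc q_def c_def)
qed

text \<open>Uniformization: \<open>e^(- t (I - K)) = e^(- t) e^(t K)\<close>. The binomial coefficients turn the defining series
  into the Cauchy product of the two exponential series.\<close>

lemma transition_semigroup_eq:
  assumes K: "stochastic (states M) (kernel M)" and x: "x \<in> states M" and y: "y \<in> states M"
  shows "transition_semigroup M t x y = exp (- t) * exp_mat (states M) (kernel M) t x y"
proof -
  define a where "a m = mat_pow (states M) (kernel M) m x y / fact m * t ^ m" for m
  define b where "b m = (- t) ^ m / fact m" for m
  have "(\<lambda>m. \<Sum>i\<le>m. a i * b (m - i)) sums ((\<Sum>m. a m) * (\<Sum>m. b m))"
  proof (rule Cauchy_product_sums)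
    show "summable (\<lambda>m. norm (a m))" using exp_mat_abs_summable[OF K x y] by (simp add: a_def)
    show "summable (\<lambda>m. norm (b m))"
      using sums_summable[OF exp_sums[of "\<bar>t\<bar>"]] by (simp add: b_def power_abs abs_mult)
  qed
  moreover have "(\<Sum>m. b m) = exp (- t)" unfolding b_def by (rule sums_unique[symmetric, OF exp_sums])
  moreover have "mat_pow (states M) (\<lambda>x y. - t * (id_mat x y - kernel M x y)) m x y / fact m
      = (\<Sum>i\<le>m. a i * b (m - i))" for m
    unfolding mat_pow_generator[OF K x y] sum_divide_distrib a_def b_def
    by (rule sum.cong) (auto simp: binomial_fact)
  ultimately show ?thesis
    by (simp add: transition_semigroup_def mat_exp_def exp_mat_def a_def sums_iff)
qed

lemma stochastic_transition_semigroup: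
  assumes K: "stochastic (states M) (kernel M)" and t: "0 \<le> t"
  shows "stochastic (states M) (transition_semigroup M t)"
  unfolding stochastic_def
proof safe
  fix x assume x: "x \<in> states M"
  show "0 \<le> transition_semigroup M t x y" if "y \<in> states M" for y
    using exp_mat_nonneg[OF K x that t] by (simp add: transition_semigroup_eq[OF K x that])
  have "((\<lambda>y. exp (- t) * exp_mat (states M) (kernel M) t x y) has_sum 1) (states M)"
    using has_sum_cmult_right[OF exp_mat_row_sum[OF K x t], of "exp (- t)"] by (simp add: exp_minus)
  then show "(transition_semigroup M t x has_sum 1) (states M)"
    by (subst has_sum_cong[OF transition_semigroup_eq[OF K x]])
qed

lemma transition_semigroup_add:
  assumes K: "stochastic (states M) (kernel M)" and x: "x \<in> states M" and y: "y \<in> states M"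
    and s: "0 \<le> s" and t: "0 \<le> t"
  shows "((\<lambda>z. transition_semigroup M s x z * transition_semigroup M t z y) has_sum
      transition_semigroup M (s + t) x y) (states M)"
proof -
  have "((\<lambda>z. exp (- (s + t)) * (exp_mat (states M) (kernel M) s x z * exp_mat (states M) (kernel M) t z y))
      has_sum transition_semigroup M (s + t) x y) (states M)"
    unfolding transition_semigroup_eq[OF K x y]
    by (rule has_sum_cmult_right[OF exp_mat_add_has_sum[OF K x y s t]])
  then show ?thesis
    by (rule has_sum_cong[THEN iffD1, rotated])
       (simp add: transition_semigroup_eq[OF K x] transition_semigroup_eq[OF K _ y] mult_exp_exp mult_ac
          flip: exp_add)
qed

lemma transition_semigroup_stationary:
  assumes K: "stochastic (states M) (kernel M)"
    and st: "stationary_distribution (states M) (kernel M) (stationary M)"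
    and y: "y \<in> states M" and t: "0 \<le> t"
  shows "((\<lambda>x. stationary M x * transition_semigroup M t x y) has_sum stationary M y) (states M)"
proof -
  have "((\<lambda>x. exp (- t) * (stationary M x * exp_mat (states M) (kernel M) t x y)) has_sum
      stationary M y) (states M)"
    using has_sum_cmult_right[OF exp_mat_stationary[OF K st y t], of "exp (- t)"]
    by (simp add: exp_minus field_simps)
  then show ?thesis
    by (rule has_sum_cong[THEN iffD1, rotated]) (simp add: transition_semigroup_eq[OF K _ y])
qed

text \<open>A bound \<open>c\<close> on a solution bounds its derivative by \<open>c\<close>, because \<open>K\<close> is stochastic; integrating from the
  initial value \<open>0\<close> improves the bound to \<open>c t\<close>, then to \<open>c t\<^sup>2 / 2\<close>, and so on. The bounds
  \<open>c t^k / k!\<close> tend to \<open>0\<close>.\<close>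

lemma backward_equation_unique:
  fixes v :: "real \<Rightarrow> 'a \<Rightarrow> real"
  assumes K: "stochastic S K"
    and deriv: "\<And>t x. 0 \<le> t \<Longrightarrow> x \<in> S \<Longrightarrow>
      ((\<lambda>t. v t x) has_real_derivative (\<Sum>\<^sub>\<infinity>z\<in>S. K x z * v t z)) (at t)"
    and zero: "\<And>x. x \<in> S \<Longrightarrow> v 0 x = 0"
    and bounded: "\<And>t x. 0 \<le> t \<Longrightarrow> t \<le> T \<Longrightarrow> x \<in> S \<Longrightarrow> \<bar>v t x\<bar> \<le> c"
    and "0 \<le> t" "t \<le> T" "x \<in> S"
  shows "v t x = 0"
proof -
  have bound: "\<bar>v t x\<bar> \<le> c * t ^ k / fact k" if "0 \<le> t" "t \<le> T" "x \<in> S" for t x k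
    using that
  proof (induction k arbitrary: t x)
    case 0
    then show ?case using bounded by simp
  next
    case (Suc k)
    define h where "h u = c * u ^ Suc k / fact (Suc k)" for u :: real
    have dh: "(h has_real_derivative c * u ^ k / fact k) (at u)" for u
    proof -
      have "(h has_real_derivative c / fact (Suc k) * (real (Suc k) * u ^ (Suc k - Suc 0))) (at u)"
        using DERIV_cmult[OF DERIV_pow[of "Suc k" u UNIV], of "c / fact (Suc k)"] by (simp add: h_def[abs_def])
      then show ?thesis by (simp add: divide_simps)
    qed
    have dv: "\<bar>\<Sum>\<^sub>\<infinity>z\<in>S. K x z * v u z\<bar> \<le> c * u ^ k / fact k" if "0 \<le> u" "u \<le> t" for u
      by (rule stochastic_apply(2)[OF K Suc.prems(3)]) (use Suc that in auto)
    have "h 0 - v 0 x \<le> h t - v t x"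
    proof (rule DERIV_nonneg_imp_nondecreasing[OF Suc.prems(1)])
      fix u assume u: "0 \<le> u" "u \<le> t"
      show "\<exists>d. ((\<lambda>u. h u - v u x) has_real_derivative d) (at u) \<and> 0 \<le> d"
        using DERIV_diff[OF dh deriv[OF u(1) Suc.prems(3)]] dv[OF u] by (force simp: abs_le_iff)
    qed
    moreover have "h 0 + v 0 x \<le> h t + v t x"
    proof (rule DERIV_nonneg_imp_nondecreasing[OF Suc.prems(1)])
      fix u assume u: "0 \<le> u" "u \<le> t"
      show "\<exists>d. ((\<lambda>u. h u + v u x) has_real_derivative d) (at u) \<and> 0 \<le> d"
        using DERIV_add[OF dh deriv[OF u(1) Suc.prems(3)]] dv[OF u] by (force simp: abs_le_iff)
    qed
    ultimately have "\<bar>v t x\<bar> \<le> h t" using zero[OF Suc.prems(3)] by (auto simp: h_def abs_le_iff)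
    then show ?case by (simp add: h_def)
  qed
  have "(\<lambda>k. c * (t ^ k / fact k)) \<longlonglongrightarrow> c * 0"
    by (intro tendsto_mult_left summable_LIMSEQ_zero sums_summable[OF exp_sums])
  then have "\<bar>v t x\<bar> \<le> 0"
    by (intro LIMSEQ_le_const[where X = "\<lambda>k. c * t ^ k / fact k"]) (use bound[OF assms(5-7)] in auto)
  then show ?thesis by simp
qed

lemma exp_mat_0:
  "exp_mat S K 0 x y = id_mat x y"
  unfolding exp_mat_def by (simp only: powser_zero) simp

lemma exp_mat_le_exp:
  assumes K: "stochastic S K" and x: "x \<in> S" and y: "y \<in> S" and t: "0 \<le> t"
  shows "exp_mat S K t x y \<le> exp t"
  by (rule has_sum_mono2[OF has_sum_finite[of "{y}" "exp_mat S K t x"] exp_mat_row_sum[OF K x t], simplified])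
     (use y exp_mat_nonneg[OF K x _ t] in auto)

lemma exp_mat_eqI:
  assumes K: "stochastic S K" and y: "y \<in> S"
    and deriv: "\<And>t x. 0 \<le> t \<Longrightarrow> x \<in> S \<Longrightarrow>
      ((\<lambda>t. u t x) has_real_derivative (\<Sum>\<^sub>\<infinity>z\<in>S. K x z * u t z)) (at t)"
    and init: "\<And>x. x \<in> S \<Longrightarrow> u 0 x = id_mat x y"
    and bound: "\<And>t x. 0 \<le> t \<Longrightarrow> x \<in> S \<Longrightarrow> 0 \<le> u t x \<and> u t x \<le> exp t"
    and t: "0 \<le> t" and x: "x \<in> S"
  shows "u t x = exp_mat S K t x y"
proof -
  define v where "v t x = u t x - exp_mat S K t x y" for t x
  have "v t x = 0"
  proof (rule backward_equation_unique[OF K, where v = v and T = t and c = "exp t"])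
    show "((\<lambda>t. v t x) has_real_derivative (\<Sum>\<^sub>\<infinity>z\<in>S. K x z * v t z)) (at t)"
      if t: "0 \<le> t" and x: "x \<in> S" for t x
    proof -
      have "((\<lambda>z. K x z * u t z + (- 1) * (K x z * exp_mat S K t z y)) has_sum
          (\<Sum>\<^sub>\<infinity>z\<in>S. K x z * u t z) + (- 1) * (\<Sum>\<^sub>\<infinity>z\<in>S. K x z * exp_mat S K t z y)) S"
        by (intro has_sum_add has_sum_cmult_right stochastic_apply(1)[OF K x, where c = "exp t"])
           (use bound exp_mat_le_exp[OF K _ y t] exp_mat_nonneg[OF K _ y t] t in auto)
      then have "(\<Sum>\<^sub>\<infinity>z\<in>S. K x z * v t z) 
          = (\<Sum>\<^sub>\<infinity>z\<in>S. K x z * u t z) - (\<Sum>\<^sub>\<infinity>z\<in>S. K x z * exp_mat S K t z y)"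
        by (intro infsumI) (simp add: v_def algebra_simps)
      then show ?thesis
        unfolding v_def using DERIV_diff[OF deriv[OF t x] exp_mat_derivative[OF K x y t]] by simp
    qed
    show "\<bar>v s x\<bar> \<le> exp t" if "0 \<le> s" "s \<le> t" "x \<in> S" for s x
    proof -
      have "exp s \<le> exp t" using that by simp
      then show ?thesis
        using bound[OF that(1,3)] exp_mat_le_exp[OF K that(3) y that(1)]
          exp_mat_nonneg[OF K that(3) y that(1)]
        unfolding v_def by linarith
    qed
  qed (use init t x in \<open>auto simp: v_def exp_mat_0\<close>)
  then show ?thesis by (simp add: v_def)
qed

section \<open>Product chains\<close>

lemma product_chain_simps [simp]:
  "states (product_chain n w F) = (\<Pi>\<^sub>E i\<in>{1..n}. states (F i))"
  "kernel (product_chain n w F) = (\<lambda>x y. \<Sum>i=1..n. w i *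
         (\<Prod>j=1..n. (if j = i then kernel (F j) else id_mat) (x j) (y j)))"
  "stationary (product_chain n w F) = (\<lambda>x. \<Prod>i=1..n. stationary (F i) (x i))"
  by (simp_all add: product_chain_def)

lemma stochastic_id_mat: "stochastic S id_mat"
  using has_sum_indicator(2)[of _ S "\<lambda>_. 1"] by (auto simp: stochastic_def id_mat_def)

lemma stochastic_product_chain:
  assumes K: "\<And>i. i \<in> {1..n} \<Longrightarrow> stochastic (states (F i)) (kernel (F i))"
    and w: "\<And>i. i \<in> {1..n} \<Longrightarrow> 0 \<le> w i" "(\<Sum>i=1..n. w i) = 1"
  shows "stochastic (states (product_chain n w F)) (kernel (product_chain n w F))"
  unfolding stochastic_def
proof safe
  fix x assume x: "x \<in> states (product_chain n w F)"
  define L where "L i j = (if j = i then kernel (F j) else id_mat)" for i j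
  have L: "stochastic (states (F j)) (L i j)" if "j \<in> {1..n}" for i j
    using K[OF that] stochastic_id_mat by (cases "j = i") (auto simp: L_def)
  have xj: "x j \<in> states (F j)" if "j \<in> {1..n}" for j using x that by auto
  show "0 \<le> kernel (product_chain n w F) x y" if y: "y \<in> states (product_chain n w F)" for y
  proof -
    have "0 \<le> L i j (x j) (y j)" if "j \<in> {1..n}" for i j
      by (rule stochasticD(1)[OF L xj]) (use y that in auto)
    then show ?thesis
      using w(1) by (auto intro!: sum_nonneg mult_nonneg_nonneg prod_nonneg simp: L_def[symmetric])
  qed
  have "((\<lambda>y. \<Sum>i=1..n. w i * (\<Prod>j=1..n. L i j (x j) (y j))) has_sum
      (\<Sum>i=1..n. w i * (\<Prod>j=1..n. 1))) (\<Pi>\<^sub>E i\<in>{1..n}. states (F i))"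
    by (intro has_sum_finite_sum has_sum_cmult_right has_sum_prod_PiE)
       (use stochasticD[OF L xj] in auto)
  then show "(kernel (product_chain n w F) x has_sum 1) (states (product_chain n w F))"
    using w(2) by (simp add: L_def)
qed

text \<open>By the product rule, the derivative of the product of exponentials is a sum over the coordinates in
  which one factor is hit by its own kernel. This is exactly the product kernel applied to the
  product, so uniqueness for the backward equation identifies the two sides.\<close>

lemma exp_mat_product_chain:
  assumes K: "\<And>i. i \<in> {1..n} \<Longrightarrow> stochastic (states (F i)) (kernel (F i))"
    and w: "\<And>i. i \<in> {1..n} \<Longrightarrow> 0 \<le> w i" "(\<Sum>i=1..n. w i) = 1"
    and x: "x \<in> states (product_chain n w F)" and y: "y \<in> states (product_chain n w F)"
    and t: "0 \<le> t"
  shows "(\<Prod>i=1..n. exp_mat (states (F i)) (kernel (F i)) (w i * t) (x i) (y i))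
    = exp_mat (states (product_chain n w F)) (kernel (product_chain n w F)) t x y"
proof -
  let ?S = "states (product_chain n w F)"
  define W where "W i = exp_mat (states (F i)) (kernel (F i))" for i
  define L where "L i j = (if j = i then kernel (F j) else id_mat)" for i j
  have yi: "y i \<in> states (F i)" if "i \<in> {1..n}" for i using y that by auto
  have W_bounds: "0 \<le> W i (w i * t) z (y i)" "W i (w i * t) z (y i) \<le> exp (w i * t)"
    if "0 \<le> t" "i \<in> {1..n}" "z \<in> states (F i)" for i t z
    using exp_mat_nonneg[OF K[OF that(2)] that(3) yi[OF that(2)], of "w i * t"] w(1)[OF that(2)]
      exp_mat_le_exp[OF K[OF that(2)] that(3) yi[OF that(2)], of "w i * t"] that(1)
    by (simp_all add: W_def)
  have "(\<Prod>i=1..n. W i (w i * t) (x i) (y i)) = exp_mat ?S (kernel (product_chain n w F)) t x y"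
  proof (rule exp_mat_eqI[where u = "\<lambda>t x. \<Prod>i=1..n. W i (w i * t) (x i) (y i)",
        OF stochastic_product_chain[OF K w] y _ _ _ t x])
    fix t :: real and x assume t: "0 \<le> t" and x: "x \<in> ?S"
    have xi: "x i \<in> states (F i)" if "i \<in> {1..n}" for i using x that by auto
    define D where "D i = (\<Sum>\<^sub>\<infinity>z\<in>states (F i). kernel (F i) (x i) z * W i (w i * t) z (y i))" for i
    have D: "((\<lambda>z. kernel (F i) (x i) z * W i (w i * t) z (y i)) has_sum D i) (states (F i))"
      if i: "i \<in> {1..n}" for i
      unfolding D_def
      by (rule stochastic_apply(1)[OF K[OF i] xi[OF i], where c = "exp (w i * t)"])
         (use W_bounds[OF t i] in auto)
    have "((\<lambda>t. W i (w i * t) (x i) (y i)) has_real_derivative w i * D i) (at t)" if i: "i \<in> {1..n}" for i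
    proof -
      have "((\<lambda>u. w i * u) has_real_derivative w i) (at t)"
        using DERIV_cmult[OF DERIV_ident, of "w i"] by simp
      moreover have "((\<lambda>u. W i u (x i) (y i)) has_real_derivative D i) (at (w i * t))"
        unfolding W_def D_def
        by (rule exp_mat_derivative[OF K[OF i] xi[OF i] yi[OF i]]) (use w(1)[OF i] t in simp)
      ultimately show ?thesis
        using DERIV_chain2[of "\<lambda>u. W i u (x i) (y i)" "D i" "\<lambda>u. w i * u" t "w i"] by (simp add: mult.commute)
    qed
    then have deriv: "((\<lambda>t. \<Prod>i=1..n. W i (w i * t) (x i) (y i)) has_real_derivative
        (\<Sum>i=1..n. w i * D i * (\<Prod>j\<in>{1..n} - {i}. W j (w j * t) (x j) (y j)))) (at t)"
      by (rule has_field_derivative_prod)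
    have "((\<lambda>z. \<Sum>i=1..n. w i * (\<Prod>j=1..n. L i j (x j) (z j) * W j (w j * t) (z j) (y j))) has_sum
        (\<Sum>i=1..n. w i * (\<Prod>j=1..n. if j = i then D j else W j (w j * t) (x j) (y j))))
        (\<Pi>\<^sub>E i\<in>{1..n}. states (F i))"
    proof (intro has_sum_finite_sum has_sum_cmult_right has_sum_prod_PiE)
      fix i j assume j: "j \<in> {1..n}"
      show "((\<lambda>z. L i j (x j) z * W j (w j * t) z (y j)) has_sum
          (if j = i then D j else W j (w j * t) (x j) (y j))) (states (F j))"
      proof (cases "j = i")
        case True
        then show ?thesis using D[OF j] by (simp add: L_def)
      next
        case False
        have "id_mat (x j) z * q = (if x j = z then q else 0)" for z and q :: real by (simp add: id_mat_def)
        then show ?thesis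
          using False has_sum_indicator(2)[OF xi[OF j], of "\<lambda>z. W j (w j * t) z (y j)"]
          by (simp add: L_def)
      qed
      have "stochastic (states (F j)) (L i j)"
        using K[OF j] stochastic_id_mat by (cases "j = i") (auto simp: L_def)
      then show "0 \<le> L i j (x j) z * W j (w j * t) z (y j)" if "z \<in> states (F j)" for z
        using stochasticD(1)[OF _ xi[OF j] that] W_bounds(1)[OF t j that] by auto
    qed auto
    moreover have "(\<Prod>j=1..n. if j = i then D j else W j (w j * t) (x j) (y j))
        = D i * (\<Prod>j\<in>{1..n} - {i}. W j (w j * t) (x j) (y j))" if "i \<in> {1..n}" for i
      using that by (subst prod.remove[of _ i]) (auto intro!: prod.cong)
    ultimately have "(\<Sum>\<^sub>\<infinity>z\<in>?S. kernel (product_chain n w F) x z * (\<Prod>i=1..n. W i (w i * t) (z i) (y i)))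
        = (\<Sum>i=1..n. w i * D i * (\<Prod>j\<in>{1..n} - {i}. W j (w j * t) (x j) (y j)))"
      by (intro infsumI) (simp add: L_def[symmetric] sum_distrib_right prod.distrib mult.assoc)
    with deriv show "((\<lambda>t. \<Prod>i=1..n. W i (w i * t) (x i) (y i)) has_real_derivative
        (\<Sum>\<^sub>\<infinity>z\<in>?S. kernel (product_chain n w F) x z * (\<Prod>i=1..n. W i (w i * t) (z i) (y i)))) (at t)"
      by simp
    have "(\<Prod>i=1..n. W i (w i * t) (x i) (y i)) \<le> (\<Prod>i=1..n. exp (w i * t))"
      by (rule prod_mono) (use W_bounds[OF t] xi in auto)
    also have "\<dots> = exp t"
      using w(2) by (simp add: exp_sum[symmetric] sum_distrib_right[symmetric])
    finally show "0 \<le> (\<Prod>i=1..n. W i (w i * t) (x i) (y i)) \<and> (\<Prod>i=1..n. W i (w i * t) (x i) (y i)) \<le> exp t"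
      using W_bounds[OF t] xi by (auto intro!: prod_nonneg)
  next
    fix x assume x: "x \<in> ?S"
    then have "x = y \<longleftrightarrow> (\<forall>i\<in>{1..n}. x i = y i)"
      using y by (auto intro: PiE_ext)
    then show "(\<Prod>i=1..n. W i (w i * 0) (x i) (y i)) = id_mat x y"
      by (auto simp: W_def exp_mat_0 id_mat_def)
  qed auto
  then show ?thesis by (simp add: W_def)
qed

lemma transition_semigroup_product_chain:
  assumes K: "\<And>i. i \<in> {1..n} \<Longrightarrow> stochastic (states (F i)) (kernel (F i))"
    and w: "\<And>i. i \<in> {1..n} \<Longrightarrow> 0 \<le> w i" "(\<Sum>i=1..n. w i) = 1"
    and x: "x \<in> states (product_chain n w F)" and y: "y \<in> states (product_chain n w F)"
    and t: "0 \<le> t"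
  shows "transition_semigroup (product_chain n w F) t x y
    = (\<Prod>i=1..n. transition_semigroup (F i) (w i * t) (x i) (y i))"
proof -
  have "(\<Prod>i=1..n. transition_semigroup (F i) (w i * t) (x i) (y i))
      = (\<Prod>i=1..n. exp (- (w i * t)) * exp_mat (states (F i)) (kernel (F i)) (w i * t) (x i) (y i))"
    by (rule prod.cong) (use x y K in \<open>auto intro!: transition_semigroup_eq\<close>)
  also have "\<dots> = exp (- t) *
      (\<Prod>i=1..n. exp_mat (states (F i)) (kernel (F i)) (w i * t) (x i) (y i))"
    using w(2) by (simp add: prod.distrib exp_sum[symmetric] sum_negf sum_distrib_right[symmetric])
  also have "\<dots> = exp (- t) * exp_mat (states (product_chain n w F)) (kernel (product_chain n w F)) t x y"
    by (subst exp_mat_product_chain[OF K w x y t]) auto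
  finally show ?thesis by (simp only: transition_semigroup_eq[OF stochastic_product_chain[OF K w] x y])
qed

section \<open>Affinities of probability vectors\<close>

definition prob_vector :: "'a set \<Rightarrow> ('a \<Rightarrow> real) \<Rightarrow> bool" where
  "prob_vector S \<mu> \<longleftrightarrow> (\<forall>y\<in>S. 0 \<le> \<mu> y) \<and> (\<mu> has_sum 1) S"

definition affinity :: "(real \<Rightarrow> real \<Rightarrow> real) \<Rightarrow> 'a set \<Rightarrow> ('a \<Rightarrow> real) \<Rightarrow> ('a \<Rightarrow> real) \<Rightarrow> real" where
  "affinity \<phi> S \<mu> \<nu> = (\<Sum>\<^sub>\<infinity>y\<in>S. \<phi> (\<mu> y) (\<nu> y))"

text \<open>The properties shared by the minimum and the geometric mean. Superadditivity and homogeneity give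
  monotonicity under stochastic matrices, supermultiplicativity gives the bound for products.\<close>

locale overlap =
  fixes \<phi> :: "real \<Rightarrow> real \<Rightarrow> real"
  assumes nonneg: "0 \<le> a \<Longrightarrow> 0 \<le> b \<Longrightarrow> 0 \<le> \<phi> a b"
    and le_mean: "0 \<le> a \<Longrightarrow> 0 \<le> b \<Longrightarrow> \<phi> a b \<le> (a + b) / 2"
    and scale: "0 \<le> a \<Longrightarrow> 0 \<le> b \<Longrightarrow> 0 \<le> c \<Longrightarrow> \<phi> (c * a) (c * b) = c * \<phi> a b"
    and superadd: "0 \<le> a \<Longrightarrow> 0 \<le> b \<Longrightarrow> 0 \<le> c \<Longrightarrow> 0 \<le> d \<Longrightarrow> \<phi> a b + \<phi> c d \<le> \<phi> (a + c) (b + d)"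
    and supermult: "0 \<le> a \<Longrightarrow> 0 \<le> b \<Longrightarrow> 0 \<le> c \<Longrightarrow> 0 \<le> d \<Longrightarrow> \<phi> a b * \<phi> c d \<le> \<phi> (a * c) (b * d)"
    and one: "\<phi> 1 1 = 1"
begin

lemma affinity_has_sum:
  assumes \<mu>: "prob_vector S \<mu>" and \<nu>: "prob_vector S \<nu>"
  shows "((\<lambda>y. \<phi> (\<mu> y) (\<nu> y)) has_sum affinity \<phi> S \<mu> \<nu>) S"
proof -
  have "((\<lambda>y. (\<mu> y + \<nu> y) * (1 / 2)) has_sum (1 + 1) * (1 / 2)) S"
    using \<mu> \<nu> unfolding prob_vector_def by (intro has_sum_cmult_left has_sum_add) auto
  then have "(\<lambda>y. (\<mu> y + \<nu> y) / 2) summable_on S" using has_sum_imp_summable by fastforce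
  then have "(\<lambda>y. \<phi> (\<mu> y) (\<nu> y)) summable_on S"
  proof (rule summable_on_comparison_test)
    fix y assume "y \<in> S"
    then have "0 \<le> \<mu> y" "0 \<le> \<nu> y" using \<mu> \<nu> by (auto simp: prob_vector_def)
    then show "\<phi> (\<mu> y) (\<nu> y) \<le> (\<mu> y + \<nu> y) / 2" "0 \<le> \<phi> (\<mu> y) (\<nu> y)"
      by (rule le_mean, rule nonneg)
  qed
  then show ?thesis by (simp add: affinity_def)
qed

lemma affinity_bounds:
  assumes \<mu>: "prob_vector S \<mu>" and \<nu>: "prob_vector S \<nu>"
  shows "0 \<le> affinity \<phi> S \<mu> \<nu>" and "affinity \<phi> S \<mu> \<nu> \<le> 1"
proof -
  show "0 \<le> affinity \<phi> S \<mu> \<nu>"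
    by (rule has_sum_nonneg[OF affinity_has_sum[OF assms]]) (use assms nonneg in \<open>auto simp: prob_vector_def\<close>)
  have "((\<lambda>y. (\<mu> y + \<nu> y) * (1 / 2)) has_sum (1 + 1) * (1 / 2)) S"
    using \<mu> \<nu> unfolding prob_vector_def by (intro has_sum_cmult_left has_sum_add) auto
  then have "((\<lambda>y. (\<mu> y + \<nu> y) / 2) has_sum 1) S" by simp
  from has_sum_mono[OF affinity_has_sum[OF assms] this]
  show "affinity \<phi> S \<mu> \<nu> \<le> 1" using assms le_mean by (auto simp: prob_vector_def)
qed

lemma sum_le:
  assumes "finite A" "\<And>x. x \<in> A \<Longrightarrow> 0 \<le> u x \<and> 0 \<le> v x"
  shows "(\<Sum>x\<in>A. \<phi> (u x) (v x)) \<le> \<phi> (\<Sum>x\<in>A. u x) (\<Sum>x\<in>A. v x)"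
  using assms
proof (induction A rule: finite_induct)
  case empty
  then show ?case using nonneg[of 0 0] by simp
next
  case (insert x A)
  have "\<phi> (u x) (v x) + \<phi> (sum u A) (sum v A) \<le> \<phi> (u x + sum u A) (v x + sum v A)"
    by (rule superadd) (use insert.prems in \<open>auto intro!: sum_nonneg\<close>)
  then show ?case using insert by simp
qed

text \<open>Superadditivity passes to infinite sums without continuity of \<open>\<phi>\<close>: the rest of the mass outside a
  finite set has nonnegative overlap.\<close>

lemma has_sum_le:
  assumes u: "\<And>x. x \<in> A \<Longrightarrow> 0 \<le> u x" "(u has_sum a) A"
    and v: "\<And>x. x \<in> A \<Longrightarrow> 0 \<le> v x" "(v has_sum b) A"
    and s: "((\<lambda>x. \<phi> (u x) (v x)) has_sum s) A"
  shows "s \<le> \<phi> a b"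
proof (rule has_sum_le_finite_sums[OF s])
  fix B assume B: "finite B" "B \<subseteq> A"
  have le: "sum u B \<le> a" "sum v B \<le> b"
    using has_sum_mono2[OF has_sum_finite[OF B(1)] u(2) B(2)] has_sum_mono2[OF has_sum_finite[OF B(1)] v(2) B(2)]
      u(1) v(1) by auto
  have pos: "0 \<le> sum u B" "0 \<le> sum v B" using B u(1) v(1) by (auto intro!: sum_nonneg)
  have "(\<Sum>x\<in>B. \<phi> (u x) (v x)) \<le> \<phi> (sum u B) (sum v B)"
    by (rule sum_le) (use B u(1) v(1) in auto)
  also have "\<dots> \<le> \<phi> (sum u B) (sum v B) + \<phi> (a - sum u B) (b - sum v B)"
    using nonneg le by simp
  also have "\<dots> \<le> \<phi> a b" using superadd[of "sum u B" "sum v B" "a - sum u B" "b - sum v B"] le pos by simp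
  finally show "(\<Sum>x\<in>B. \<phi> (u x) (v x)) \<le> \<phi> a b" .
qed

text \<open>Data processing: merging mass along \<open>Q\<close> can only make two probability vectors harder to
  distinguish.\<close>

lemma affinity_contraction:
  assumes \<mu>: "prob_vector S \<mu>" and \<nu>: "prob_vector S \<nu>"
    and Q: "\<And>x. x \<in> S \<Longrightarrow> prob_vector S' (Q x)"
    and \<mu>': "prob_vector S' \<mu>'" "\<And>y. y \<in> S' \<Longrightarrow> ((\<lambda>x. \<mu> x * Q x y) has_sum \<mu>' y) S"
    and \<nu>': "prob_vector S' \<nu>'" "\<And>y. y \<in> S' \<Longrightarrow> ((\<lambda>x. \<nu> x * Q x y) has_sum \<nu>' y) S"
  shows "affinity \<phi> S \<mu> \<nu> \<le> affinity \<phi> S' \<mu>' \<nu>'"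
proof -
  have pos: "\<And>x. x \<in> S \<Longrightarrow> 0 \<le> \<mu> x" "\<And>x. x \<in> S \<Longrightarrow> 0 \<le> \<nu> x" 
    "\<And>x y. x \<in> S \<Longrightarrow> y \<in> S' \<Longrightarrow> 0 \<le> Q x y"
    using \<mu> \<nu> Q by (auto simp: prob_vector_def)
  define f where "f x y = \<phi> (\<mu> x * Q x y) (\<nu> x * Q x y)" for x y
  have f: "f x y = \<phi> (\<mu> x) (\<nu> x) * Q x y" if "x \<in> S" "y \<in> S'" for x y
    using scale[OF pos(1,2,3)] that by (simp add: f_def mult.commute)
  have f0: "0 \<le> f x y" if "x \<in> S" "y \<in> S'" for x y
    using pos that nonneg by (simp add: f_def)
  have rows: "(f x has_sum \<phi> (\<mu> x) (\<nu> x)) S'" if "x \<in> S" for x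
  proof -
    have "((\<lambda>y. \<phi> (\<mu> x) (\<nu> x) * Q x y) has_sum \<phi> (\<mu> x) (\<nu> x)) S'"
      using has_sum_cmult_right[of "Q x" S' 1 "\<phi> (\<mu> x) (\<nu> x)"] Q[OF that] by (simp add: prob_vector_def)
    then show ?thesis by (subst has_sum_cong[OF f[OF that]])
  qed
  have columns: "((\<lambda>x. f x y) has_sum (\<Sum>\<^sub>\<infinity>x\<in>S. f x y)) S" if "y \<in> S'" for y
    using summable_on_column_nonneg[OF f0 rows affinity_has_sum[OF \<mu> \<nu>] that] by simp
  have "((\<lambda>y. \<Sum>\<^sub>\<infinity>x\<in>S. f x y) has_sum affinity \<phi> S \<mu> \<nu>) S'"
    by (rule has_sum_swap_nonneg[OF f0 rows affinity_has_sum[OF \<mu> \<nu>] columns])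
  then show ?thesis
  proof (rule has_sum_mono[OF _ affinity_has_sum[OF \<mu>'(1) \<nu>'(1)]])
    fix y assume y: "y \<in> S'"
    show "(\<Sum>\<^sub>\<infinity>x\<in>S. f x y) \<le> \<phi> (\<mu>' y) (\<nu>' y)"
      by (rule has_sum_le[OF _ \<mu>'(2)[OF y] _ \<nu>'(2)[OF y] columns[OF y, unfolded f_def], folded f_def])
         (use pos y in auto)
  qed
qed

lemma prod_le:
  assumes "finite A" "\<And>x. x \<in> A \<Longrightarrow> 0 \<le> u x \<and> 0 \<le> v x"
  shows "(\<Prod>x\<in>A. \<phi> (u x) (v x)) \<le> \<phi> (\<Prod>x\<in>A. u x) (\<Prod>x\<in>A. v x)"
  using assms
proof (induction A rule: finite_induct)
  case empty
  then show ?case by (simp add: one)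
next
  case (insert x A)
  have "\<phi> (u x) (v x) * (\<Prod>x\<in>A. \<phi> (u x) (v x)) \<le> \<phi> (u x) (v x) * \<phi> (prod u A) (prod v A)"
    by (rule mult_left_mono) (use insert nonneg in auto)
  also have "\<dots> \<le> \<phi> (u x * prod u A) (v x * prod v A)"
    by (rule supermult) (use insert.prems in \<open>auto intro!: prod_nonneg\<close>)
  finally show ?case using insert by simp
qed

end

lemma prob_vector_PiE:
  assumes "finite A" and \<mu>: "\<And>i. i \<in> A \<Longrightarrow> prob_vector (S i) (\<mu> i)"
  shows "prob_vector (PiE A S) (\<lambda>x. \<Prod>i\<in>A. \<mu> i (x i))"
proof -
  have "((\<lambda>x. \<Prod>i\<in>A. \<mu> i (x i)) has_sum (\<Prod>i\<in>A. 1)) (PiE A S)"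
    by (rule has_sum_prod_PiE) (use assms in \<open>auto simp: prob_vector_def\<close>)
  then show ?thesis using \<mu> by (auto simp: prob_vector_def PiE_iff intro!: prod_nonneg)
qed

lemma marginal_PiE:
  assumes A: "finite A" "i \<in> A" and \<mu>: "\<And>i. i \<in> A \<Longrightarrow> prob_vector (S i) (\<mu> i)" and b: "b \<in> S i"
  shows "((\<lambda>x. (\<Prod>j\<in>A. \<mu> j (x j)) * id_mat (x i) b) has_sum \<mu> i b) (PiE A S)"
proof -
  have "((\<lambda>x. \<Prod>j\<in>A. \<mu> j (x j) * (if j = i then id_mat (x j) b else 1)) has_sum
      (\<Prod>j\<in>A. if j = i then \<mu> i b else 1)) (PiE A S)"
  proof (rule has_sum_prod_PiE[OF A(1)])
    fix j assume j: "j \<in> A"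
    show "((\<lambda>z. \<mu> j z * (if j = i then id_mat z b else 1)) has_sum (if j = i then \<mu> i b else 1)) (S j)"
    proof (cases "j = i")
      case True
      have "q * id_mat z b = (if z = b then q else 0)" for z and q :: real by (simp add: id_mat_def)
      then show ?thesis using True has_sum_indicator(1)[OF b, of "\<mu> i"] by simp
    qed (use \<mu>[OF j] in \<open>auto simp: prob_vector_def\<close>)
  qed (use \<mu> in \<open>auto simp: prob_vector_def id_mat_def\<close>)
  then show ?thesis using A by (simp add: prod.distrib)
qed

text \<open>The coordinate projection is a deterministic stochastic matrix from the product space to one factor.\<close>

lemma (in overlap) affinity_PiE_le_marginal:
  assumes A: "finite A" "i \<in> A"
    and \<mu>: "\<And>i. i \<in> A \<Longrightarrow> prob_vector (S i) (\<mu> i)" and \<nu>: "\<And>i. i \<in> A \<Longrightarrow> prob_vector (S i) (\<nu> i)"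
  shows "affinity \<phi> (PiE A S) (\<lambda>x. \<Prod>i\<in>A. \<mu> i (x i)) (\<lambda>x. \<Prod>i\<in>A. \<nu> i (x i)) \<le> affinity \<phi> (S i) (\<mu> i) (\<nu> i)"
proof (rule affinity_contraction[where Q = "\<lambda>x. id_mat (x i)"])
  show "prob_vector (S i) (id_mat (x i))" if "x \<in> PiE A S" for x
    using stochastic_id_mat[of "S i"] that A by (auto simp: stochastic_def prob_vector_def PiE_iff)
qed (use A in \<open>auto intro!: marginal_PiE prob_vector_PiE \<mu> \<nu>\<close>)

lemma (in overlap) prod_affinity_le_affinity_PiE:
  assumes A: "finite A"
    and \<mu>: "\<And>i. i \<in> A \<Longrightarrow> prob_vector (S i) (\<mu> i)" and \<nu>: "\<And>i. i \<in> A \<Longrightarrow> prob_vector (S i) (\<nu> i)"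
  shows "(\<Prod>i\<in>A. affinity \<phi> (S i) (\<mu> i) (\<nu> i))
    \<le> affinity \<phi> (PiE A S) (\<lambda>x. \<Prod>i\<in>A. \<mu> i (x i)) (\<lambda>x. \<Prod>i\<in>A. \<nu> i (x i))"
proof (rule has_sum_mono)
  have pos: "\<And>i z. i \<in> A \<Longrightarrow> z \<in> S i \<Longrightarrow> 0 \<le> \<mu> i z \<and> 0 \<le> \<nu> i z" using \<mu> \<nu> by (auto simp: prob_vector_def)
  show "((\<lambda>x. \<Prod>i\<in>A. \<phi> (\<mu> i (x i)) (\<nu> i (x i))) has_sum (\<Prod>i\<in>A. affinity \<phi> (S i) (\<mu> i) (\<nu> i))) (PiE A S)"
    by (rule has_sum_prod_PiE[OF A _ affinity_has_sum[OF \<mu> \<nu>]]) (use pos nonneg in auto)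
  show "((\<lambda>x. \<phi> (\<Prod>i\<in>A. \<mu> i (x i)) (\<Prod>i\<in>A. \<nu> i (x i))) has_sum
      affinity \<phi> (PiE A S) (\<lambda>x. \<Prod>i\<in>A. \<mu> i (x i)) (\<lambda>x. \<Prod>i\<in>A. \<nu> i (x i))) (PiE A S)"
    by (rule affinity_has_sum[OF prob_vector_PiE prob_vector_PiE]) (use A \<mu> \<nu> in auto)
  show "(\<Prod>i\<in>A. \<phi> (\<mu> i (x i)) (\<nu> i (x i))) \<le> \<phi> (\<Prod>i\<in>A. \<mu> i (x i)) (\<Prod>i\<in>A. \<nu> i (x i))"
    if "x \<in> PiE A S" for x
    by (rule prod_le[OF A]) (use pos that in auto)
qed

definition geo_mean :: "real \<Rightarrow> real \<Rightarrow> real" where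
  "geo_mean a b = sqrt (a * b)"

interpretation min: overlap min
proof
  show "min a b * min c d \<le> min (a * c) (b * d)" if "0 \<le> a" "0 \<le> b" "0 \<le> c" "0 \<le> d" for a b c d :: real
    using that by (auto intro!: mult_mono)
  show "min (c * a) (c * b) = c * min a b" if "0 \<le> c" for a b c :: real
    using that by (simp add: min_mult_distrib_left)
qed auto

interpretation geo_mean: overlap geo_mean
proof
  show "geo_mean a b \<le> (a + b) / 2" if "0 \<le> a" "0 \<le> b" for a b :: real
    using arith_geo_mean_sqrt[OF that] by (simp add: geo_mean_def)
  show "geo_mean (c * a) (c * b) = c * geo_mean a b" if "0 \<le> c" for a b c :: real
    using that by (simp add: geo_mean_def real_sqrt_mult)
  show "geo_mean a b + geo_mean c d \<le> geo_mean (a + c) (b + d)"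
    if *: "0 \<le> a" "0 \<le> b" "0 \<le> c" "0 \<le> d" for a b c d :: real
    unfolding geo_mean_def
  proof (rule real_le_rsqrt)
    have "2 * sqrt ((a * d) * (c * b)) \<le> a * d + c * b"
      using arith_geo_mean_sqrt[of "a * d" "c * b"] * by simp
    then show "(sqrt (a * b) + sqrt (c * d))\<^sup>2 \<le> (a + c) * (b + d)"
      using * by (simp add: power2_sum real_sqrt_mult algebra_simps)
  qed
qed (auto simp: geo_mean_def real_sqrt_mult)

section \<open>Distance to stationarity\<close>

text \<open>The setting in which the distances to stationarity are studied. Products inherit it, so that the facts
  below apply to the factors and to the product chains alike.\<close>

definition stationary_chain :: "'a chain \<Rightarrow> bool" where
  "stationary_chain M \<longleftrightarrow> stochastic (states M) (kernel M) \<and>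
     stationary_distribution (states M) (kernel M) (stationary M)"

lemma irreducible_chain_imp_stationary_chain: "irreducible_chain M \<Longrightarrow> stationary_chain M"
  by (simp add: irreducible_chain_def stationary_chain_def)

lemma stationary_chainD:
  assumes "stationary_chain M"
  shows "prob_vector (states M) (stationary M)" and "states M \<noteq> {}"
    and "0 \<le> t \<Longrightarrow> x \<in> states M \<Longrightarrow> prob_vector (states M) (transition_semigroup M t x)"
proof -
  show \<pi>: "prob_vector (states M) (stationary M)"
    using assms by (simp add: stationary_chain_def stationary_distribution_def prob_vector_def)
  then show "states M \<noteq> {}" using has_sum_unique[OF has_sum_empty] by (force simp: prob_vector_def)
  show "prob_vector (states M) (transition_semigroup M t x)" if "0 \<le> t" "x \<in> states M"
    using stochastic_transition_semigroup[of M t] assms that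
    by (auto simp: stationary_chain_def stochastic_def prob_vector_def)
qed

lemma stationary_chain_product_chain:
  assumes M: "\<And>i. i \<in> {1..n} \<Longrightarrow> stationary_chain (F i)"
    and w: "\<And>i. i \<in> {1..n} \<Longrightarrow> 0 \<le> w i" "(\<Sum>i=1..n. w i) = 1"
  shows "stationary_chain (product_chain n w F)"
  unfolding stationary_chain_def stationary_distribution_def
proof (intro conjI ballI)
  let ?P = "product_chain n w F"
  have K: "\<And>i. i \<in> {1..n} \<Longrightarrow> stochastic (states (F i)) (kernel (F i))"
    and st: "\<And>i. i \<in> {1..n} \<Longrightarrow>
      stationary_distribution (states (F i)) (kernel (F i)) (stationary (F i))"
    using M by (auto simp: stationary_chain_def)
  show "stochastic (states ?P) (kernel ?P)" by (rule stochastic_product_chain[OF K w])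
  have pv: "prob_vector (states ?P) (stationary ?P)"
    using prob_vector_PiE[of "{1..n}" "\<lambda>i. states (F i)" "\<lambda>i. stationary (F i)"] stationary_chainD(1)[OF M]
    by simp
  then show "(stationary ?P has_sum 1) (states ?P)"
    and "\<And>x. x \<in> states ?P \<Longrightarrow> 0 \<le> stationary ?P x"
    by (auto simp: prob_vector_def)
  fix y assume y: "y \<in> states ?P"
  define L where "L i j = (if j = i then kernel (F j) else id_mat)" for i j
  have "((\<lambda>x. \<Sum>i=1..n. w i * (\<Prod>j=1..n. stationary (F j) (x j) * L i j (x j) (y j))) has_sum
      (\<Sum>i=1..n. w i * (\<Prod>j=1..n. stationary (F j) (y j)))) (\<Pi>\<^sub>E i\<in>{1..n}. states (F i))"
  proof (intro has_sum_finite_sum has_sum_cmult_right has_sum_prod_PiE)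
    fix i j assume j: "j \<in> {1..n}"
    have yj: "y j \<in> states (F j)" using y j by auto
    show "((\<lambda>z. stationary (F j) z * L i j z (y j)) has_sum stationary (F j) (y j)) (states (F j))"
    proof (cases "j = i")
      case True
      then show ?thesis using st[OF j] yj by (simp add: L_def stationary_distribution_def)
    next
      case False
      have "q * id_mat z (y j) = (if z = y j then q else 0)" for z and q :: real by (simp add: id_mat_def)
      then show ?thesis using False has_sum_indicator(1)[OF yj, of "stationary (F j)"] by (simp add: L_def)
    qed
    have "stochastic (states (F j)) (L i j)"
      using K[OF j] stochastic_id_mat by (cases "j = i") (auto simp: L_def)
    then show "0 \<le> stationary (F j) z * L i j z (y j)" if "z \<in> states (F j)" for z
      using stochasticD(1)[OF _ that yj] st[OF j] that by (auto simp: stationary_distribution_def)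
  qed auto
  then show "((\<lambda>x. stationary ?P x * kernel ?P x y) has_sum stationary ?P y) (states ?P)"
    using w(2) by (simp add: L_def[symmetric] prod.distrib sum_distrib_left sum_distrib_right[symmetric] mult_ac)
qed

definition worst_gap :: "(real \<Rightarrow> real \<Rightarrow> real) \<Rightarrow> 'a chain \<Rightarrow> real \<Rightarrow> real" where
  "worst_gap \<phi> M t =
     (SUP x\<in>states M. 1 - affinity \<phi> (states M) (transition_semigroup M t x) (stationary M))"

context overlap
begin

lemma gap_bounds:
  assumes "stationary_chain M" "0 \<le> t" "x \<in> states M"
  shows "0 \<le> 1 - affinity \<phi> (states M) (transition_semigroup M t x) (stationary M)"
    and "1 - affinity \<phi> (states M) (transition_semigroup M t x) (stationary M) \<le> 1"
  using affinity_bounds[OF stationary_chainD(3)[OF assms] stationary_chainD(1)[OF assms(1)]] by auto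

lemma gap_le_worst_gap:
  assumes "stationary_chain M" "0 \<le> t" "x \<in> states M"
  shows "1 - affinity \<phi> (states M) (transition_semigroup M t x) (stationary M) \<le> worst_gap \<phi> M t"
  unfolding worst_gap_def
  by (rule cSUP_upper[OF assms(3)]) (rule bdd_aboveI2[OF gap_bounds(2)[OF assms(1,2)]])

lemma worst_gap_le:
  assumes "stationary_chain M"
    and "\<And>x. x \<in> states M \<Longrightarrow> 1 - affinity \<phi> (states M) (transition_semigroup M t x) (stationary M) \<le> c"
  shows "worst_gap \<phi> M t \<le> c"
  unfolding worst_gap_def by (rule cSUP_least[OF stationary_chainD(2)[OF assms(1)] assms(2)])

lemma worst_gap_bounds:
  assumes "stationary_chain M" "0 \<le> t"
  shows "0 \<le> worst_gap \<phi> M t" and "worst_gap \<phi> M t \<le> 1"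
proof -
  obtain x where x: "x \<in> states M" using stationary_chainD(2)[OF assms(1)] by auto
  show "0 \<le> worst_gap \<phi> M t"
    using gap_bounds(1)[OF assms x] gap_le_worst_gap[OF assms x] by linarith
  show "worst_gap \<phi> M t \<le> 1" by (rule worst_gap_le[OF assms(1) gap_bounds(2)[OF assms]])
qed

lemma worst_gap_antimono:
  assumes M: "stationary_chain M" and s: "0 \<le> s" and st: "s \<le> t"
  shows "worst_gap \<phi> M t \<le> worst_gap \<phi> M s"
proof (rule worst_gap_le[OF M])
  fix x assume x: "x \<in> states M"
  have K: "stochastic (states M) (kernel M)" "stationary_distribution (states M) (kernel M) (stationary M)"
    using M by (auto simp: stationary_chain_def)
  have "affinity \<phi> (states M) (transition_semigroup M s x) (stationary M)
      \<le> affinity \<phi> (states M) (transition_semigroup M t x) (stationary M)"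
  proof (rule affinity_contraction[where Q = "transition_semigroup M (t - s)"])
    show "((\<lambda>z. transition_semigroup M s x z * transition_semigroup M (t - s) z y) has_sum
        transition_semigroup M t x y) (states M)" if "y \<in> states M" for y
      using transition_semigroup_add[OF K(1) x that s, of "t - s"] st by simp
    show "((\<lambda>z. stationary M z * transition_semigroup M (t - s) z y) has_sum stationary M y) (states M)"
      if "y \<in> states M" for y
      using transition_semigroup_stationary[OF K that] st by simp
  qed (use stationary_chainD[OF M] x s st in auto)
  then show "1 - affinity \<phi> (states M) (transition_semigroup M t x) (stationary M) \<le> worst_gap \<phi> M s"
    using gap_le_worst_gap[OF M s x] by linarith
qed

text \<open>For the lower bound, a starting state of one factor is extended to the other coordinates, whose state
  spaces are nonempty because they carry stationary laws.\<close>

lemma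
  assumes M: "\<And>i. i \<in> {1..n} \<Longrightarrow> stationary_chain (F i)"
    and w: "\<And>i. i \<in> {1..n} \<Longrightarrow> 0 \<le> w i" "(\<Sum>i=1..n. w i) = 1" and t: "0 \<le> t"
  shows worst_gap_factor_le_product:
      "i \<in> {1..n} \<Longrightarrow> worst_gap \<phi> (F i) (w i * t) \<le> worst_gap \<phi> (product_chain n w F) t"
    and worst_gap_product_le:
      "worst_gap \<phi> (product_chain n w F) t \<le> 1 - (\<Prod>i=1..n. 1 - worst_gap \<phi> (F i) (w i * t))"
proof -
  let ?P = "product_chain n w F"
  define S where "S i = states (F i)" for i
  define \<mu> where "\<mu> x i = transition_semigroup (F i) (w i * t) (x i)" for x i
  define \<pi> where "\<pi> i = stationary (F i)" for i
  have S: "states ?P = PiE {1..n} S" by (simp add: S_def[abs_def])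
  have K: "\<And>i. i \<in> {1..n} \<Longrightarrow> stochastic (states (F i)) (kernel (F i))"
    using M by (auto simp: stationary_chain_def)
  have wt: "0 \<le> w i * t" if "i \<in> {1..n}" for i using w(1)[OF that] t by simp
  have \<pi>: "prob_vector (S i) (\<pi> i)" if "i \<in> {1..n}" for i
    using stationary_chainD(1)[OF M[OF that]] by (simp add: S_def \<pi>_def)
  have \<mu>: "prob_vector (S i) (\<mu> x i)" if "i \<in> {1..n}" "x \<in> PiE {1..n} S" for i x
    using stationary_chainD(3)[OF M[OF that(1)] wt[OF that(1)], of "x i"] that
    by (auto simp: S_def \<mu>_def PiE_iff)
  have aff: "affinity \<phi> (states ?P) (transition_semigroup ?P t x) (stationary ?P)
      = affinity \<phi> (PiE {1..n} S) (\<lambda>y. \<Prod>i\<in>{1..n}. \<mu> x i (y i)) (\<lambda>y. \<Prod>i\<in>{1..n}. \<pi> i (y i))"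
    if "x \<in> PiE {1..n} S" for x
    unfolding affinity_def S
    by (rule infsum_cong)
       (use transition_semigroup_product_chain[OF K w _ _ t, where x = x] that
        in \<open>auto simp: S_def[abs_def] \<mu>_def \<pi>_def\<close>)
  have gap: "1 - affinity \<phi> (S i) (\<mu> x i) (\<pi> i) \<le> worst_gap \<phi> (F i) (w i * t)"
    if "i \<in> {1..n}" "x \<in> PiE {1..n} S" for i x
    using gap_le_worst_gap[OF M[OF that(1)] wt[OF that(1)], of "x i"] that
    by (auto simp: S_def \<mu>_def \<pi>_def PiE_iff)
  have ne: "PiE {1..n} S \<noteq> {}"
    using stationary_chainD(2)[OF M] by (auto simp: S_def PiE_eq_empty_iff)
  have P: "stationary_chain ?P" by (rule stationary_chain_product_chain[OF M w])
  have up: "1 - affinity \<phi> (states ?P) (transition_semigroup ?P t x) (stationary ?P) \<le> worst_gap \<phi> ?P t"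
    if "x \<in> PiE {1..n} S" for x
    by (rule gap_le_worst_gap[OF P t]) (simp only: S that)
  show "worst_gap \<phi> (F i) (w i * t) \<le> worst_gap \<phi> ?P t" if i: "i \<in> {1..n}"
  proof (rule worst_gap_le[OF M[OF i]])
    fix a assume a: "a \<in> states (F i)"
    obtain x0 where x0: "x0 \<in> PiE {1..n} S" using ne by auto
    define x where "x = x0(i := a)"
    have x: "x \<in> PiE {1..n} S" using x0 i a by (auto simp: x_def S_def PiE_iff extensional_def)
    have "affinity \<phi> (PiE {1..n} S) (\<lambda>y. \<Prod>i\<in>{1..n}. \<mu> x i (y i)) (\<lambda>y. \<Prod>i\<in>{1..n}. \<pi> i (y i))
        \<le> affinity \<phi> (S i) (\<mu> x i) (\<pi> i)"
      by (rule affinity_PiE_le_marginal) (use \<mu> \<pi> x i in auto)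
    moreover have "\<mu> x i = transition_semigroup (F i) (w i * t) a" by (simp add: \<mu>_def x_def)
    ultimately show "1 - affinity \<phi> (states (F i)) (transition_semigroup (F i) (w i * t) a) (stationary (F i))
        \<le> worst_gap \<phi> ?P t"
      using up[OF x, unfolded aff[OF x]] by (simp only: S_def \<pi>_def)
  qed
  show "worst_gap \<phi> ?P t \<le> 1 - (\<Prod>i=1..n. 1 - worst_gap \<phi> (F i) (w i * t))"
  proof (rule worst_gap_le[OF P])
    fix x assume "x \<in> states ?P"
    then have x: "x \<in> PiE {1..n} S" by (simp only: S)
    have "(\<Prod>i=1..n. 1 - worst_gap \<phi> (F i) (w i * t)) \<le> (\<Prod>i=1..n. affinity \<phi> (S i) (\<mu> x i) (\<pi> i))"
    proof (rule prod_mono, intro conjI)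
      fix i assume i: "i \<in> {1..n}"
      show "0 \<le> 1 - worst_gap \<phi> (F i) (w i * t)" using worst_gap_bounds(2)[OF M[OF i] wt[OF i]] by simp
      show "1 - worst_gap \<phi> (F i) (w i * t) \<le> affinity \<phi> (S i) (\<mu> x i) (\<pi> i)"
        using gap[OF i x] by simp
    qed
    also have "\<dots> \<le> affinity \<phi> (PiE {1..n} S) (\<lambda>y. \<Prod>i\<in>{1..n}. \<mu> x i (y i)) (\<lambda>y. \<Prod>i\<in>{1..n}. \<pi> i (y i))"
      by (rule prod_affinity_le_affinity_PiE) (use \<mu> \<pi> x in auto)
    finally show "1 - affinity \<phi> (states ?P) (transition_semigroup ?P t x) (stationary ?P)
        \<le> 1 - (\<Prod>i=1..n. 1 - worst_gap \<phi> (F i) (w i * t))"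
      using aff[OF x] by linarith
  qed
qed

end

text \<open>The excess of \<open>H x\<close> over \<open>\<pi>\<close> has total mass \<open>1 - affinity min\<close>, and the set where \<open>H x\<close> exceeds \<open>\<pi>\<close>
  attains the supremum over the events.\<close>

lemma tv_dist_eq:
  assumes M: "stationary_chain M" and t: "0 \<le> t"
  shows "tv_dist M t = worst_gap min M t"
proof -
  let ?S = "states M" and ?\<pi> = "stationary M"
  define H where "H = transition_semigroup M t"
  have H: "prob_vector ?S (H x)" if "x \<in> ?S" for x
    using stationary_chainD(3)[OF M t that] by (simp add: H_def)
  have \<pi>: "prob_vector ?S ?\<pi>" by (rule stationary_chainD(1)[OF M])
  have excess: "((\<lambda>y. H x y - min (H x y) (?\<pi> y)) has_sum 1 - affinity min ?S (H x) ?\<pi>) ?S" if "x \<in> ?S" for x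
    using has_sum_add[OF _ has_sum_cmult_right[OF min.affinity_has_sum[OF H[OF that] \<pi>], of "-1"], of "H x" 1]
      H[OF that] by (simp add: prob_vector_def)
  have diff: "((\<lambda>y. H x y - ?\<pi> y) has_sum (\<Sum>\<^sub>\<infinity>y\<in>A. H x y) - (\<Sum>\<^sub>\<infinity>y\<in>A. ?\<pi> y)) A" if "x \<in> ?S" "A \<subseteq> ?S" for x A
  proof -
    have "H x summable_on A" "?\<pi> summable_on A"
      using H[OF that(1)] \<pi> that(2) summable_on_subset_banach has_sum_imp_summable
      by (metis prob_vector_def)+
    then show ?thesis
      using has_sum_add[OF has_sum_infsum has_sum_cmult_right[OF has_sum_infsum, of ?\<pi> A "-1"], of "H x"] by simp
  qed
  have le: "(\<Sum>\<^sub>\<infinity>y\<in>A. H x y) - (\<Sum>\<^sub>\<infinity>y\<in>A. ?\<pi> y) \<le> 1 - affinity min ?S (H x) ?\<pi>" if "x \<in> ?S" "A \<subseteq> ?S" for x A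
    by (rule has_sum_mono_neutral[OF diff[OF that] excess[OF that(1)]]) (use that in auto)
  have eq: "(\<Sum>\<^sub>\<infinity>y\<in>A. H x y) - (\<Sum>\<^sub>\<infinity>y\<in>A. ?\<pi> y) = 1 - affinity min ?S (H x) ?\<pi>"
    if "x \<in> ?S" "A = {y \<in> ?S. ?\<pi> y < H x y}" for x A
  proof -
    have "((\<lambda>y. H x y - ?\<pi> y) has_sum 1 - affinity min ?S (H x) ?\<pi>) A"
      by (rule has_sum_cong_neutral[THEN iffD1, OF _ _ _ excess[OF that(1)]]) (use that in auto)
    then show ?thesis using diff[OF that(1), of A] that(2) has_sum_unique by blast
  qed
  show ?thesis
  proof (rule antisym)
    show "tv_dist M t \<le> worst_gap min M t"
      unfolding tv_dist_def
    proof (rule cSUP_least, unfold split_paired_all case_prod_conv H_def[symmetric])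
      show "?S \<times> Pow ?S \<noteq> {}" using stationary_chainD(2)[OF M] by auto
      fix x A assume "(x, A) \<in> ?S \<times> Pow ?S"
      then have x: "x \<in> ?S" "A \<subseteq> ?S" by auto
      from le[OF x] min.gap_le_worst_gap[OF M t x(1)]
      show "(\<Sum>\<^sub>\<infinity>y\<in>A. H x y) - (\<Sum>\<^sub>\<infinity>y\<in>A. ?\<pi> y) \<le> worst_gap min M t"
        unfolding H_def by linarith
    qed
    show "worst_gap min M t \<le> tv_dist M t"
    proof (rule min.worst_gap_le[OF M])
      fix x assume x: "x \<in> ?S"
      define A where "A = {y \<in> ?S. ?\<pi> y < H x y}"
      have "(case (x, A) of (x, A) \<Rightarrow> (\<Sum>\<^sub>\<infinity>y\<in>A. H x y) - (\<Sum>\<^sub>\<infinity>y\<in>A. ?\<pi> y)) \<le> tv_dist M t"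
        unfolding tv_dist_def H_def[symmetric]
      proof (rule cSUP_upper)
        show "(x, A) \<in> ?S \<times> Pow ?S" using x by (auto simp: A_def)
        show "bdd_above ((\<lambda>(x, A). (\<Sum>\<^sub>\<infinity>y\<in>A. H x y) - (\<Sum>\<^sub>\<infinity>y\<in>A. ?\<pi> y)) ` (?S \<times> Pow ?S))"
        proof (rule bdd_aboveI2[where M = 1], unfold split_paired_all case_prod_conv)
          fix x A assume "(x, A) \<in> ?S \<times> Pow ?S"
          then have x: "x \<in> ?S" "A \<subseteq> ?S" by auto
          from le[OF x] min.gap_bounds(2)[OF M t x(1)]
          show "(\<Sum>\<^sub>\<infinity>y\<in>A. H x y) - (\<Sum>\<^sub>\<infinity>y\<in>A. ?\<pi> y) \<le> 1" unfolding H_def by linarith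
        qed
      qed
      then show "1 - affinity min ?S (transition_semigroup M t x) ?\<pi> \<le> tv_dist M t"
        using eq[OF x A_def] by (simp add: H_def)
    qed
  qed
qed

lemma hellinger_dist_eq:
  assumes M: "stationary_chain M" and t: "0 \<le> t"
  shows "hellinger_dist M t = sqrt (worst_gap geo_mean M t)"
proof -
  let ?S = "states M" and ?\<pi> = "stationary M"
  define H where "H = transition_semigroup M t"
  define a where "a x = affinity geo_mean ?S (H x) ?\<pi>" for x
  have a: "1 / 2 * (\<Sum>\<^sub>\<infinity>y\<in>?S. (sqrt (H x y) - sqrt (?\<pi> y))\<^sup>2) = 1 - a x" if x: "x \<in> ?S" for x
  proof -
    have H: "prob_vector ?S (H x)" using stationary_chainD(3)[OF M t x] by (simp add: H_def)
    have \<pi>: "prob_vector ?S ?\<pi>" by (rule stationary_chainD(1)[OF M])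
    have "((\<lambda>y. (H x y + ?\<pi> y) + (- 2) * geo_mean (H x y) (?\<pi> y)) has_sum (1 + 1) + (- 2) * a x) ?S"
      unfolding a_def
      by (intro has_sum_add has_sum_cmult_right geo_mean.affinity_has_sum H \<pi>)
         (use H \<pi> in \<open>auto simp: prob_vector_def\<close>)
    then have "((\<lambda>y. (sqrt (H x y) - sqrt (?\<pi> y))\<^sup>2) has_sum (1 + 1) + (- 2) * a x) ?S"
      by (rule has_sum_cong[THEN iffD1, rotated])
         (use H \<pi> in \<open>auto simp: prob_vector_def geo_mean_def power2_diff real_sqrt_mult\<close>)
    from infsumI[OF this] show ?thesis by simp
  qed
  have d: "hellinger_dist M t = (SUP x\<in>?S. sqrt (1 - a x))"
    unfolding hellinger_dist_def H_def[symmetric] by (rule SUP_cong) (simp_all only: a)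
  have ne: "?S \<noteq> {}" by (rule stationary_chainD(2)[OF M])
  have up: "1 - a x \<le> worst_gap geo_mean M t" if "x \<in> ?S" for x
    using geo_mean.gap_le_worst_gap[OF M t that] by (simp add: a_def H_def)
  have a01: "0 \<le> 1 - a x" if "x \<in> ?S" for x
    using geo_mean.gap_bounds[OF M t that] by (simp add: a_def H_def)
  have bdd: "bdd_above ((\<lambda>x. sqrt (1 - a x)) ` ?S)"
    by (rule bdd_aboveI2[where M = "sqrt (worst_gap geo_mean M t)"]) (use up in simp)
  show ?thesis unfolding d
  proof (rule antisym)
    show "(SUP x\<in>?S. sqrt (1 - a x)) \<le> sqrt (worst_gap geo_mean M t)"
      by (rule cSUP_least[OF ne]) (use up in simp)
    define u where "u = (SUP x\<in>?S. sqrt (1 - a x))"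
    have u: "sqrt (1 - a x) \<le> u" if "x \<in> ?S" for x
      unfolding u_def by (rule cSUP_upper[OF that bdd])
    have "worst_gap geo_mean M t \<le> u\<^sup>2"
    proof (rule geo_mean.worst_gap_le[OF M])
      fix x assume x: "x \<in> ?S"
      show "1 - affinity geo_mean ?S (transition_semigroup M t x) ?\<pi> \<le> u\<^sup>2"
        using power_mono[OF u[OF x], of 2] a01[OF x] by (simp add: a_def H_def)
    qed
    moreover obtain x where x: "x \<in> ?S" using ne by auto
    then have "0 \<le> u" using u[OF x] a01[OF x] real_sqrt_ge_zero order_trans by blast
    ultimately show "sqrt (worst_gap geo_mean M t) \<le> (SUP x\<in>?S. sqrt (1 - a x))"
      using real_le_lsqrt u_def by blast
  qed
qed

lemma abs_diff_has_sum:
  assumes \<mu>: "prob_vector S \<mu>" and \<nu>: "prob_vector S \<nu>"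
  shows "((\<lambda>y. \<bar>\<mu> y - \<nu> y\<bar>) has_sum 2 * (1 - affinity min S \<mu> \<nu>)) S"
proof -
  have "((\<lambda>y. (\<mu> y + \<nu> y) + (- 2) * min (\<mu> y) (\<nu> y)) has_sum (1 + 1) + (- 2) * affinity min S \<mu> \<nu>) S"
    by (intro has_sum_add has_sum_cmult_right min.affinity_has_sum \<mu> \<nu>)
       (use \<mu> \<nu> in \<open>auto simp: prob_vector_def\<close>)
  moreover have "(a + b) + (- 2) * min a b = \<bar>a - b\<bar>" for a b :: real by linarith
  ultimately show ?thesis by simp
qed

text \<open>Twice the total variation gap is the supremum of the \<open>\<ell>\<^sup>1\<close> norms of the rows of \<open>H t - \<Pi>\<close>, where all rows of
  \<open>\<Pi>\<close> are \<open>\<pi>\<close>. The factorization \<open>H (s + t) - \<Pi> = (H s - \<Pi>) (H t - \<Pi>)\<close> makes it submultiplicative.\<close>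

lemma worst_gap_min_submultiplicative:
  assumes M: "stationary_chain M" and s: "0 \<le> s" and t: "0 \<le> t"
  shows "2 * worst_gap min M (s + t) \<le> (2 * worst_gap min M s) * (2 * worst_gap min M t)"
proof -
  let ?S = "states M" and ?\<pi> = "stationary M"
  define H where "H = transition_semigroup M"
  have K: "stochastic ?S (kernel M)" "stationary_distribution ?S (kernel M) ?\<pi>"
    using M by (auto simp: stationary_chain_def)
  have \<pi>: "prob_vector ?S ?\<pi>" by (rule stationary_chainD(1)[OF M])
  have H: "prob_vector ?S (H u x)" if "0 \<le> u" "x \<in> ?S" for u x
    using stationary_chainD(3)[OF M that] by (simp add: H_def)
  have H_nonneg: "0 \<le> H u x y" and H_le_1: "H u x y \<le> 1" if "0 \<le> u" "x \<in> ?S" "y \<in> ?S" for u x y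
    using stochasticD[OF stochastic_transition_semigroup[OF K(1) that(1)] that(2)] that(3)
    by (auto simp: H_def)
  define \<delta> where "\<delta> u x y = \<bar>H u x y - ?\<pi> y\<bar>" for u x y
  define l where "l u x = 2 * (1 - affinity min ?S (H u x) ?\<pi>)" for u x
  have \<delta>: "(\<delta> u x has_sum l u x) ?S" if "0 \<le> u" "x \<in> ?S" for u x
    unfolding \<delta>_def[abs_def] l_def by (rule abs_diff_has_sum[OF H[OF that] \<pi>])
  have l_le: "l u x \<le> 2 * worst_gap min M u" and l_nonneg: "0 \<le> l u x" if "0 \<le> u" "x \<in> ?S" for u x
    using min.gap_le_worst_gap[OF M that] min.gap_bounds[OF M that] by (simp_all add: l_def H_def)
  have main: "l (s + t) x \<le> (2 * worst_gap min M s) * (2 * worst_gap min M t)" if x: "x \<in> ?S" for x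
  proof -
    have bound: "((\<lambda>z. \<delta> s x z * (2 * worst_gap min M t)) has_sum l s x * (2 * worst_gap min M t)) ?S"
      by (rule has_sum_cmult_left[OF \<delta>[OF s x]])
    have "(\<lambda>z. \<delta> s x z * l t z) summable_on ?S"
      by (rule summable_on_comparison_test[OF has_sum_imp_summable[OF bound]])
         (use l_le[OF t] l_nonneg[OF t] in \<open>auto simp: \<delta>_def intro!: mult_left_mono\<close>)
    then obtain V where V: "((\<lambda>z. \<delta> s x z * l t z) has_sum V) ?S" by (auto simp: summable_on_def)
    have "V \<le> l s x * (2 * worst_gap min M t)"
      by (rule has_sum_mono[OF V bound]) (use l_le[OF t] in \<open>auto simp: \<delta>_def intro!: mult_left_mono\<close>)
    also have "\<dots> \<le> (2 * worst_gap min M s) * (2 * worst_gap min M t)"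
      by (rule mult_right_mono[OF l_le[OF s x]]) (use min.worst_gap_bounds(1)[OF M t] in simp)
    finally have V_le: "V \<le> (2 * worst_gap min M s) * (2 * worst_gap min M t)" .
    have f0: "0 \<le> \<delta> s x z * \<delta> t z y" for z y by (simp add: \<delta>_def)
    have rows: "((\<lambda>y. \<delta> s x z * \<delta> t z y) has_sum \<delta> s x z * l t z) ?S" if "z \<in> ?S" for z
      by (rule has_sum_cmult_right[OF \<delta>[OF t that]])
    have columns: "((\<lambda>z. \<delta> s x z * \<delta> t z y) has_sum (\<Sum>\<^sub>\<infinity>z\<in>?S. \<delta> s x z * \<delta> t z y)) ?S" if "y \<in> ?S" for y
      using summable_on_column_nonneg[OF f0 rows V that] by simp
    have "((\<lambda>y. \<Sum>\<^sub>\<infinity>z\<in>?S. \<delta> s x z * \<delta> t z y) has_sum V) ?S"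
      by (rule has_sum_swap_nonneg[OF f0 rows V columns])
    then have "l (s + t) x \<le> V"
    proof (rule has_sum_mono[OF \<delta>[OF add_nonneg_nonneg[OF s t] x]])
      fix y assume y: "y \<in> ?S"
      \<comment> \<open>Since \<open>\<pi>\<close> is stationary and \<open>H s x - \<pi>\<close> has total mass zero,
        \<open>H (s + t) x - \<pi>\<close> is the product of \<open>H s x - \<pi>\<close> and \<open>H t - \<pi>\<close>.\<close>
      have sum: "((\<lambda>z. (H s x z * H t z y + (- 1) * (?\<pi> z * H t z y)) + (- ?\<pi> y) * (H s x z + (- 1) * ?\<pi> z))
          has_sum (H (s + t) x y + (- 1) * ?\<pi> y) + (- ?\<pi> y) * (1 + (- 1) * 1)) ?S"
        unfolding H_def
        by (intro has_sum_add has_sum_cmult_right transition_semigroup_add[OF K(1) x y s t]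
            transition_semigroup_stationary[OF K y t])
           (use H[OF s x] \<pi> in \<open>auto simp: prob_vector_def H_def\<close>)
      have "((\<lambda>z. (H s x z - ?\<pi> z) * (H t z y - ?\<pi> y)) has_sum (H (s + t) x y - ?\<pi> y)) ?S"
        using sum by (simp add: algebra_simps)
      from has_sum_mono[OF this columns[OF y]] has_sum_mono[OF has_sum_cmult_right[OF this, of "-1"] columns[OF y]]
      show "\<delta> (s + t) x y \<le> (\<Sum>\<^sub>\<infinity>z\<in>?S. \<delta> s x z * \<delta> t z y)"
        by (auto simp: \<delta>_def abs_mult[symmetric] abs_le_iff)
    qed
    with V_le show ?thesis by linarith
  qed
  have "worst_gap min M (s + t) \<le> ((2 * worst_gap min M s) * (2 * worst_gap min M t)) / 2"
  proof (rule min.worst_gap_le[OF M])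
    fix x assume "x \<in> ?S"
    from divide_right_mono[OF main[OF this], of 2]
    show "1 - affinity min ?S (transition_semigroup M (s + t) x) ?\<pi>
        \<le> ((2 * worst_gap min M s) * (2 * worst_gap min M t)) / 2"
      by (simp add: l_def H_def)
  qed
  then show ?thesis by simp
qed

lemma worst_gap_min_power:
  assumes M: "stationary_chain M" and t: "0 \<le> t"
  shows "2 * worst_gap min M (real (Suc k) * t) \<le> (2 * worst_gap min M t) ^ Suc k"
proof (induction k)
  case 0
  then show ?case by simp
next
  case (Suc k)
  have "2 * worst_gap min M (real (Suc (Suc k)) * t) = 2 * worst_gap min M (t + real (Suc k) * t)"
    by (simp add: algebra_simps)
  also have "\<dots> \<le> (2 * worst_gap min M t) * (2 * worst_gap min M (real (Suc k) * t))"
    by (rule worst_gap_min_submultiplicative[OF M t]) (use t in simp)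
  also have "\<dots> \<le> (2 * worst_gap min M t) * (2 * worst_gap min M t) ^ Suc k"
    by (rule mult_left_mono[OF Suc]) (use min.worst_gap_bounds(1)[OF M t] in simp)
  finally show ?case by simp
qed

lemma worst_gap_geo_mean_le_min:
  assumes M: "stationary_chain M" and t: "0 \<le> t"
  shows "worst_gap geo_mean M t \<le> worst_gap min M t"
proof (rule geo_mean.worst_gap_le[OF M])
  fix x assume x: "x \<in> states M"
  note pv = stationary_chainD(3)[OF M t x] stationary_chainD(1)[OF M]
  have "affinity min (states M) (transition_semigroup M t x) (stationary M)
      \<le> affinity geo_mean (states M) (transition_semigroup M t x) (stationary M)"
  proof (rule has_sum_mono[OF min.affinity_has_sum[OF pv] geo_mean.affinity_has_sum[OF pv]])
    fix y assume "y \<in> states M"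
    then have *: "0 \<le> transition_semigroup M t x y" "0 \<le> stationary M y"
      using pv by (auto simp: prob_vector_def)
    have "min a b \<le> geo_mean a b" if "0 \<le> a" "0 \<le> b" for a b
      unfolding geo_mean_def
      by (rule real_le_rsqrt) (use that in \<open>auto simp: power2_eq_square intro!: mult_mono\<close>)
    then show "min (transition_semigroup M t x y) (stationary M y)
        \<le> geo_mean (transition_semigroup M t x y) (stationary M y)" using * by blast
  qed
  then show "1 - affinity geo_mean (states M) (transition_semigroup M t x) (stationary M) \<le> worst_gap min M t"
    using min.gap_le_worst_gap[OF M t x] by linarith
qed

text \<open>A linearized form of \<open>d_TV \<le> \<surd>2 d_H\<close>. Its constants are chosen so that a Hellinger distance of at
  most \<open>1/4\<close> makes the right-hand side at most \<open>17/24 < 1\<close>, which is what the decay estimate needs.\<close>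

lemma worst_gap_min_le_geo_mean:
  assumes M: "stationary_chain M" and t: "0 \<le> t"
  shows "2 * worst_gap min M t \<le> 6 * worst_gap geo_mean M t + 1 / 3"
proof -
  let ?\<pi> = "stationary M"
  have "worst_gap min M t \<le> (6 * worst_gap geo_mean M t + 1 / 3) / 2"
  proof (rule min.worst_gap_le[OF M])
    fix x assume x: "x \<in> states M"
    define \<mu> where "\<mu> = transition_semigroup M t x"
    have pv: "prob_vector (states M) \<mu>" "prob_vector (states M) ?\<pi>"
      using stationary_chainD(3)[OF M t x] stationary_chainD(1)[OF M] by (simp_all add: \<mu>_def)
    have "((\<lambda>y. (19 / 6) * (\<mu> y + ?\<pi> y) + (- 6) * geo_mean (\<mu> y) (?\<pi> y)) has_sum
        (19 / 6) * (1 + 1) + (- 6) * affinity geo_mean (states M) \<mu> ?\<pi>) (states M)"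
      by (intro has_sum_add has_sum_cmult_right geo_mean.affinity_has_sum pv)
         (use pv in \<open>auto simp: prob_vector_def\<close>)
    with abs_diff_has_sum[OF pv]
    have "2 * (1 - affinity min (states M) \<mu> ?\<pi>)
        \<le> (19 / 6) * (1 + 1) + (- 6) * affinity geo_mean (states M) \<mu> ?\<pi>"
    proof (rule has_sum_mono)
      fix y assume "y \<in> states M"
      then have *: "0 \<le> \<mu> y" "0 \<le> ?\<pi> y" using pv by (auto simp: prob_vector_def)
      have "\<bar>a\<^sup>2 - b\<^sup>2\<bar> \<le> (19 / 6) * (a\<^sup>2 + b\<^sup>2) + (- 6) * (a * b)" for a b :: real
      proof -
        \<comment> \<open>\<open>2 \<bar>u v\<bar> \<le> 6 u\<^sup>2 + v\<^sup>2 / 6\<close> with \<open>u = a - b\<close> and \<open>v = a + b\<close>.\<close>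
        have "0 \<le> (6 * (a - b) - (a + b))\<^sup>2" "0 \<le> (6 * (a - b) + (a + b))\<^sup>2" "0 \<le> (a - b)\<^sup>2" by simp_all
        then show ?thesis by (auto simp: power2_eq_square algebra_simps abs_if)
      qed
      from this[of "sqrt (\<mu> y)" "sqrt (?\<pi> y)"] *
      show "\<bar>\<mu> y - ?\<pi> y\<bar> \<le> (19 / 6) * (\<mu> y + ?\<pi> y) + (- 6) * geo_mean (\<mu> y) (?\<pi> y)"
        by (simp add: geo_mean_def real_sqrt_mult)
    qed
    moreover have "1 - affinity geo_mean (states M) \<mu> ?\<pi> \<le> worst_gap geo_mean M t"
      using geo_mean.gap_le_worst_gap[OF M t x] by (simp add: \<mu>_def)
    ultimately show "1 - affinity min (states M) (transition_semigroup M t x) ?\<pi>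
        \<le> (6 * worst_gap geo_mean M t + 1 / 3) / 2" by (simp add: \<mu>_def)
  qed
  then show ?thesis by simp
qed

lemma power_le_inverse_linear:
  fixes r :: real
  assumes r: "0 \<le> r" "r < 1"
  shows "r ^ k \<le> 1 / ((1 - r) * (real k + 1))"
proof -
  have "(real k + 1) * r ^ k = (\<Sum>j\<le>k. r ^ k)" by simp
  also have "\<dots> \<le> (\<Sum>j\<le>k. r ^ j)" by (rule sum_mono) (use r in \<open>auto intro: power_decreasing\<close>)
  also have "\<dots> = (1 - r ^ Suc k) / (1 - r)" using r by (simp add: sum_gp0)
  also have "\<dots> \<le> 1 / (1 - r)" using r by (intro divide_right_mono) auto
  finally have "r ^ k * ((1 - r) * (real k + 1)) \<le> 1" using r by (simp add: pos_le_divide_eq mult_ac)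
  then show ?thesis using r by (subst pos_le_divide_eq) auto
qed

text \<open>Geometric decay on the scale \<open>2 T\<close>, weakened to the order \<open>T / s\<close>. The weak form is linear in \<open>T\<close>, so
  it turns geometric growth of the mixing times directly into a geometric series. A time strictly
  after \<open>T\<close> is used, as the infimum defining the mixing time need not be attained.\<close>

lemma worst_gap_min_decay:
  assumes M: "stationary_chain M" and T: "0 < T" and r: "0 \<le> r" "r < 1"
    and small: "2 * worst_gap min M (2 * T) \<le> r" and s: "0 < s"
  shows "worst_gap min M s \<le> 2 / (1 - r) * (T / s)"
proof -
  define k where "k = nat \<lfloor>s / (2 * T)\<rfloor>"
  have k: "real k \<le> s / (2 * T)" "s / (2 * T) < real k + 1"
    using T s by (auto simp: k_def)
  have "worst_gap min M s \<le> r ^ k"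
  proof (cases k)
    case 0
    then show ?thesis using min.worst_gap_bounds(2)[OF M, of s] s by simp
  next
    case (Suc j)
    have "worst_gap min M s \<le> worst_gap min M (real k * (2 * T))"
      by (rule min.worst_gap_antimono[OF M]) (use k T in \<open>auto simp: field_simps\<close>)
    also have "\<dots> \<le> 2 * worst_gap min M (real (Suc j) * (2 * T))"
      using min.worst_gap_bounds(1)[OF M, of "real k * (2 * T)"] T by (simp add: Suc)
    also have "\<dots> \<le> (2 * worst_gap min M (2 * T)) ^ Suc j"
      by (rule worst_gap_min_power[OF M]) (use T in simp)
    also have "\<dots> \<le> r ^ Suc j"
      by (rule power_mono[OF small]) (use min.worst_gap_bounds(1)[OF M, of "2 * T"] T in simp)
    finally show ?thesis by (simp add: Suc)
  qed
  also have "\<dots> \<le> 1 / ((1 - r) * (real k + 1))" by (rule power_le_inverse_linear[OF r])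
  also have "\<dots> \<le> 1 / ((1 - r) * (s / (2 * T)))"
  proof (rule divide_left_mono)
    show "(1 - r) * (s / (2 * T)) \<le> (1 - r) * (real k + 1)"
      by (rule mult_left_mono) (use k(2) r in auto)
  qed (use r T s in auto)
  also have "\<dots> = 2 / (1 - r) * (T / s)" by simp
  finally show ?thesis .
qed

section \<open>Cutoffs of products on a common time scale\<close>

text \<open>The situation after the change of time scale: \<open>g n\<close> and \<open>G n\<close> are the gaps of the \<open>n\<close>-th factor and
  of the \<open>n\<close>-th product, and \<open>E n\<close> is the mixing time of the \<open>n\<close>-th factor. The
  constants \<open>\<delta>\<close> and \<open>\<eta>\<close> separate the gap before \<open>E n\<close> from \<open>0\<close> and the gap after it from \<open>1\<close>.\<close>

locale rescaled_family =
  fixes g G :: "nat \<Rightarrow> real \<Rightarrow> real" and E :: "nat \<Rightarrow> real" and \<delta> \<eta> L c \<rho> :: real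
  assumes g_bounds: "1 \<le> n \<Longrightarrow> 0 < s \<Longrightarrow> 0 \<le> g n s \<and> g n s \<le> 1"
    and g_antimono: "1 \<le> n \<Longrightarrow> 0 < s \<Longrightarrow> s \<le> t \<Longrightarrow> g n t \<le> g n s"
    and E_pos: "1 \<le> n \<Longrightarrow> 0 < E n"
    and before: "1 \<le> n \<Longrightarrow> 0 < s \<Longrightarrow> s < E n \<Longrightarrow> \<delta> \<le> g n s" and \<delta>_pos: "0 < \<delta>"
    and after: "1 \<le> n \<Longrightarrow> E n < s \<Longrightarrow> g n s \<le> \<eta>" and \<eta>_less_1: "\<eta> < 1"
    and decay: "1 \<le> n \<Longrightarrow> 0 < s \<Longrightarrow> g n s \<le> L * (E n / s)" and L_nonneg: "0 \<le> L"
    and growth: "1 \<le> i \<Longrightarrow> i \<le> n \<Longrightarrow> E i \<le> c * \<rho> ^ (n - i) * E n"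
    and c_pos: "0 < c" and \<rho>: "0 < \<rho>" "\<rho> < 1"
    and E_mono: "\<exists>N. \<forall>i n. N \<le> i \<longrightarrow> i \<le> n \<longrightarrow> E i \<le> E n"
    and factor_le: "1 \<le> i \<Longrightarrow> i \<le> n \<Longrightarrow> 0 < s \<Longrightarrow> g i s \<le> G n s"
    and product_le: "1 \<le> n \<Longrightarrow> 0 < s \<Longrightarrow> G n s \<le> 1 - (\<Prod>i=1..n. 1 - g i s)"
begin

lemma G_bounds:
  assumes "1 \<le> n" "0 < s"
  shows "0 \<le> G n s" "G n s \<le> 1"
proof -
  show "0 \<le> G n s" using g_bounds[OF assms] factor_le[OF assms(1) order_refl assms(2)] by linarith
  have "0 \<le> (\<Prod>i=1..n. 1 - g i s)" by (rule prod_nonneg) (use g_bounds assms in auto)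
  then show "G n s \<le> 1" using product_le[OF assms] by linarith
qed

lemma G_le_sum:
  assumes "1 \<le> n" "0 < s"
  shows "G n s \<le> (\<Sum>i=1..n. g i s)"
  using product_le[OF assms] Weierstrass_prod_ineq[of "{1..n}" "\<lambda>i. g i s"] g_bounds assms by fastforce

lemma decay_back:
  assumes "1 \<le> i" "i \<le> n" "0 < s"
  shows "g i s \<le> L * c * \<rho> ^ (n - i) * (E n / s)"
proof -
  have "g i s \<le> L * (E i / s)" by (rule decay) (use assms in auto)
  also have "\<dots> \<le> L * (c * \<rho> ^ (n - i) * E n / s)"
    by (intro mult_left_mono divide_right_mono growth L_nonneg) (use assms in auto)
  finally show ?thesis by simp
qed

text \<open>The gap before the mixing time \<open>E n\<close> is bounded below and the gap after it is bounded away from one;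
  so limits \<open>0\<close> and \<open>1\<close> of the gap locate \<open>u n\<close> relative to \<open>E n\<close>.\<close>

lemma eventually_E_le:
  assumes pos: "\<And>n. 1 \<le> n \<Longrightarrow> 0 < u n" and lim: "(\<lambda>n. g n (u n)) \<longlonglongrightarrow> 0"
  shows "eventually (\<lambda>n. E n \<le> u n) sequentially"
  using order_tendstoD(2)[OF lim \<delta>_pos] eventually_ge_at_top[of 1]
proof eventually_elim
  case (elim n)
  then show ?case using before[of n "u n"] pos[of n] by fastforce
qed

lemma eventually_le_E:
  assumes lim: "(\<lambda>n. g n (u n)) \<longlonglongrightarrow> 1"
  shows "eventually (\<lambda>n. u n \<le> E n) sequentially"
  using order_tendstoD(1)[OF lim \<eta>_less_1] eventually_ge_at_top[of 1]
proof eventually_elim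
  case (elim n)
  then show ?case using after[of n "u n"] by fastforce
qed

lemma cutoff_transfers_to_products:
  assumes cutoff: "has_cutoff_time g u"
  shows "has_cutoff_time G u"
proof -
  have u: "\<And>n. 1 \<le> n \<Longrightarrow> 0 < u n" and sub: "\<And>a. 1 < a \<Longrightarrow> (\<lambda>n. g n (a * u n)) \<longlonglongrightarrow> 0"
    and sup: "\<And>a. 0 < a \<Longrightarrow> a < 1 \<Longrightarrow> (\<lambda>n. g n (a * u n)) \<longlonglongrightarrow> 1"
    using cutoff by (auto simp: has_cutoff_time_def)
  have "(\<lambda>n. G n (a * u n)) \<longlonglongrightarrow> 0" if a: "1 < a" for a
  proof -
    \<comment> \<open>The slack in \<open>a > 1\<close> is split three ways, \<open>a * \<beta> = b\<^sup>2\<close>: once \<open>\<beta> * u i \<le> E i\<close>,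
      \<open>E i \<le> E n\<close> and \<open>E n \<le> b * u n\<close>, the time \<open>a * u n\<close> is after \<open>b * u i\<close>.\<close>
    define \<beta> where "\<beta> = (1 + 1 / a) / 2"
    have \<beta>: "0 < \<beta>" "\<beta> < 1" "1 < a * \<beta>" using a by (auto simp: \<beta>_def field_simps)
    define b where "b = sqrt (a * \<beta>)"
    have b: "1 < b" "a * \<beta> / b = b" using \<beta> a by (auto simp: b_def real_div_sqrt)
    have E_le_a: "eventually (\<lambda>n. E n \<le> a * u n) sequentially"
      by (rule eventually_E_le[OF _ sub[OF a]]) (use u a in auto)
    have E_le_b: "eventually (\<lambda>n. E n \<le> b * u n) sequentially"
      by (rule eventually_E_le[OF _ sub[OF b(1)]]) (use u b in auto)
    have E_ge: "eventually (\<lambda>n. \<beta> * u n \<le> E n) sequentially"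
      by (rule eventually_le_E[OF sup[OF \<beta>(1,2)]])
    obtain N where N: "\<And>i n. N \<le> i \<Longrightarrow> i \<le> n \<Longrightarrow> E i \<le> E n" using E_mono by blast
    \<comment> \<open>Counting the factors backwards from \<open>n\<close> gives sums dominated by one geometric series.\<close>
    define h where "h j n = (if j < n then g (n - j) (a * u n) else 0)" for j n
    have h_lim: "h j \<longlonglongrightarrow> 0" for j
    proof (rule tendsto_sandwich)
      show "(\<lambda>_. 0 :: real) \<longlonglongrightarrow> 0" by simp
      show "eventually (\<lambda>n. 0 \<le> h j n) sequentially"
        by (rule always_eventually) (use g_bounds u a in \<open>auto simp: h_def\<close>)
      have shift: "filterlim (\<lambda>n. n - j) sequentially sequentially"
        by (rule filterlim_minus_const_nat_at_top)
      show "(\<lambda>n. g (n - j) (b * u (n - j))) \<longlonglongrightarrow> 0"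
        by (rule filterlim_compose[OF sub[OF b(1)] shift])
      have "eventually (\<lambda>n. \<beta> * u (n - j) \<le> E (n - j)) sequentially"
        by (rule eventually_compose_filterlim[OF E_ge shift])
      then show "eventually (\<lambda>n. h j n \<le> g (n - j) (b * u (n - j))) sequentially"
        using E_le_b eventually_ge_at_top[of "N + j"] eventually_gt_at_top[of j]
      proof eventually_elim
        case (elim n)
        have "\<beta> * u (n - j) \<le> b * u n"
          using elim N[of "n - j" n] by linarith
        then have "a / b * (\<beta> * u (n - j)) \<le> a / b * (b * u n)"
          by (rule mult_left_mono) (use a b in auto)
        moreover have "a / b * (\<beta> * u (n - j)) = (a * \<beta> / b) * u (n - j)" by simp
        ultimately have "b * u (n - j) \<le> a * u n" unfolding b(2) using b(1) by simp
        then show ?case using elim u[of "n - j"] b by (auto simp: h_def intro!: g_antimono)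
      qed
    qed
    have bound: "eventually (\<lambda>n. \<forall>j. norm (h j n) \<le> L * c * \<rho> ^ j) sequentially"
      using E_le_a eventually_ge_at_top[of 1]
    proof eventually_elim
      case (elim n)
      have au: "0 < a * u n" using u elim a by simp
      have "norm (h j n) \<le> L * c * \<rho> ^ j" for j
      proof (cases "j < n")
        case True
        have "g (n - j) (a * u n) \<le> L * c * \<rho> ^ (n - (n - j)) * (E n / (a * u n))"
          by (rule decay_back) (use True au in auto)
        also have "\<dots> \<le> L * c * \<rho> ^ (n - (n - j)) * 1"
          by (rule mult_left_mono) (use elim au L_nonneg c_pos \<rho> in auto)
        finally show ?thesis using True g_bounds[of "n - j" "a * u n"] au by (simp add: h_def)
      qed (use L_nonneg c_pos \<rho> in \<open>auto simp: h_def\<close>)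
      then show ?case by blast
    qed
    have "(\<lambda>n. \<Sum>j. h j n) \<longlonglongrightarrow> (\<Sum>j. 0)"
    proof (rule conjunct2[OF conjunct2[OF tannerys_theorem]])
      show "eventually (\<lambda>(j, n). norm (h j n) \<le> L * c * \<rho> ^ j) (sequentially \<times>\<^sub>F sequentially)"
        unfolding eventually_prod_filter using bound
        by (intro exI[of _ "\<lambda>_. True"] exI[of _ "\<lambda>n. \<forall>j. norm (h j n) \<le> L * c * \<rho> ^ j"]) auto
      show "summable (\<lambda>j. L * c * \<rho> ^ j)" using \<rho> by (intro summable_mult summable_geometric) auto
    qed (use h_lim in auto)
    then have lim: "(\<lambda>n. \<Sum>j. h j n) \<longlonglongrightarrow> 0" by simp
    have G_le: "G n (a * u n) \<le> (\<Sum>j. h j n)" if n: "1 \<le> n" for n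
    proof -
      have "G n (a * u n) \<le> (\<Sum>i=1..n. g i (a * u n))" by (rule G_le_sum[OF n]) (use u[OF n] a in auto)
      also have "\<dots> = (\<Sum>j<n. h j n)"
        by (rule sum.reindex_bij_witness[where i = "\<lambda>j. n - j" and j = "\<lambda>i. n - i"]) (auto simp: h_def)
      also have "\<dots> = (\<Sum>j. h j n)" by (rule suminf_finite[symmetric]) (auto simp: h_def)
      finally show ?thesis .
    qed
    show ?thesis
    proof (rule tendsto_sandwich[OF _ _ tendsto_const lim])
      show "eventually (\<lambda>n. 0 \<le> G n (a * u n)) sequentially"
        by (rule eventually_sequentiallyI[of 1]) (use G_bounds u a in auto)
      show "eventually (\<lambda>n. G n (a * u n) \<le> (\<Sum>j. h j n)) sequentially"
        by (rule eventually_sequentiallyI[of 1]) (use G_le in auto)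
    qed
  qed
  moreover have "(\<lambda>n. G n (a * u n)) \<longlonglongrightarrow> 1" if a: "0 < a" "a < 1" for a
  proof (rule tendsto_sandwich[OF _ _ sup[OF a] tendsto_const])
    show "eventually (\<lambda>n. g n (a * u n) \<le> G n (a * u n)) sequentially"
      by (rule eventually_sequentiallyI[of 1]) (use factor_le u a in auto)
    show "eventually (\<lambda>n. G n (a * u n) \<le> 1) sequentially"
      by (rule eventually_sequentiallyI[of 1]) (use G_bounds u a in auto)
  qed
  ultimately show ?thesis using u by (simp add: has_cutoff_time_def)
qed

text \<open>Here \<open>m\<close> is chosen so large that the factors more than \<open>m\<close> places before \<open>n\<close> have gaps of total sum
  at most \<open>1/2\<close> at every time at least \<open>E n / 4\<close>. They cannot be responsible for a product gap near
  one, and the number of the others is at most \<open>m + 1\<close>, independently of \<open>n\<close>.\<close>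

lemma product_cutoff_yields_late_factor:
  assumes u: "\<And>n. 1 \<le> n \<Longrightarrow> 0 < u n" and E_le: "eventually (\<lambda>n. E n \<le> 2 * u n) sequentially"
    and m: "4 * L * c * \<rho> ^ m / (1 - \<rho>) \<le> 1 / 2"
    and a: "1 / 2 \<le> a" and lim: "(\<lambda>n. G n (a * u n)) \<longlonglongrightarrow> 1" and b: "b < 1"
  shows "eventually (\<lambda>n. \<exists>i. 1 \<le> i \<and> i \<le> n \<and> n \<le> i + m \<and> b < g i (a * u n)) sequentially"
proof -
  define b' where "b' = max b 0"
  have b': "0 \<le> b'" "b' < 1" "b \<le> b'" using b by (auto simp: b'_def)
  have "1 - 1 / 2 * (1 - b') ^ Suc m < 1" using b' by simp
  from order_tendstoD(1)[OF lim this] E_le eventually_ge_at_top[of 1]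
  show ?thesis
  proof eventually_elim
    case (elim n)
    define s where "s = a * u n"
    have s: "0 < s" "E n \<le> 4 * s"
    proof -
      show "0 < s" using u[OF elim(3)] a by (simp add: s_def)
      have "2 * u n \<le> 4 * s"
        using mult_right_mono[OF a, of "4 * u n"] u[OF elim(3)] by (simp add: s_def)
      then show "E n \<le> 4 * s" using elim(2) by linarith
    qed
    have g: "0 \<le> g i s" "g i s \<le> 1" if "1 \<le> i" for i using g_bounds[OF that s(1)] by auto
    define far where "far = {i \<in> {1..n}. i + m < n}"
    define near where "near = {i \<in> {1..n}. n \<le> i + m}"
    have split: "{1..n} = far \<union> near" "far \<inter> near = {}" "finite far" "finite near"
      by (auto simp: far_def near_def)
    have "(\<Sum>i\<in>far. g i s) \<le> (\<Sum>i\<in>far. 4 * L * c * \<rho> ^ (n - i))"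
    proof (rule sum_mono)
      fix i assume i: "i \<in> far"
      have "g i s \<le> L * c * \<rho> ^ (n - i) * (E n / s)"
        by (rule decay_back) (use i s in \<open>auto simp: far_def\<close>)
      also have "\<dots> \<le> L * c * \<rho> ^ (n - i) * 4"
        by (rule mult_left_mono) (use s L_nonneg c_pos \<rho> in \<open>auto simp: field_simps\<close>)
      finally show "g i s \<le> 4 * L * c * \<rho> ^ (n - i)" by simp
    qed
    also have "\<dots> = 4 * L * c * (\<Sum>j\<in>(\<lambda>i. n - i) ` far. \<rho> ^ j)"
      by (subst sum.reindex) (auto simp: far_def inj_on_def sum_distrib_left)
    also have "\<dots> \<le> 4 * L * c * (\<Sum>j. \<rho> ^ (j + m))"
    proof (rule mult_left_mono)
      have "(\<Sum>j\<in>(\<lambda>i. n - i) ` far. \<rho> ^ j) = (\<Sum>j\<in>(\<lambda>i. n - i - m) ` far. \<rho> ^ (j + m))"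
        by (rule sum.reindex_bij_witness[where i = "\<lambda>j. j + m" and j = "\<lambda>j. j - m"])
           (auto simp: far_def image_iff)
      also have "\<dots> \<le> (\<Sum>j. \<rho> ^ (j + m))"
        using \<rho> by (intro sum_le_suminf) (auto simp: far_def power_add intro!: summable_mult2 summable_geometric)
      finally show "(\<Sum>j\<in>(\<lambda>i. n - i) ` far. \<rho> ^ j) \<le> (\<Sum>j. \<rho> ^ (j + m))" .
    qed (use L_nonneg c_pos in simp)
    also have "(\<Sum>j. \<rho> ^ (j + m)) = \<rho> ^ m / (1 - \<rho>)"
      using \<rho> suminf_mult2[OF summable_geometric, of \<rho> "\<rho> ^ m"] suminf_geometric[of \<rho>]
      by (simp add: power_add)
    finally have "(\<Sum>i\<in>far. g i s) \<le> 1 / 2" using m by simp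
    then have far: "1 / 2 \<le> (\<Prod>i\<in>far. 1 - g i s)"
      using Weierstrass_prod_ineq[of far "\<lambda>i. g i s"] g by (force simp: far_def)
    show ?case
    proof (rule ccontr)
      assume none: "\<not> ?thesis"
      have g_near: "g i s \<le> b'" if "i \<in> near" for i
        using none that b' by (force simp: near_def s_def)
      have "card near \<le> Suc m"
      proof -
        have "near \<subseteq> {n - m..n}" by (auto simp: near_def)
        from card_mono[OF _ this] show ?thesis by simp
      qed
      then have "(1 - b') ^ Suc m \<le> (1 - b') ^ card near" using b' by (intro power_decreasing) auto
      also have "\<dots> = (\<Prod>i\<in>near. 1 - b')" by simp
      also have "\<dots> \<le> (\<Prod>i\<in>near. 1 - g i s)" by (rule prod_mono) (use g_near b' in auto)
      finally have "1 / 2 * (1 - b') ^ Suc m \<le> (\<Prod>i\<in>far. 1 - g i s) * (\<Prod>i\<in>near. 1 - g i s)"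
        by (intro mult_mono far) (use b' far in auto)
      also have "\<dots> = (\<Prod>i=1..n. 1 - g i s)"
        unfolding split(1) by (rule prod.union_disjoint[symmetric]) (use split in auto)
      finally show False using product_le[OF elim(3) s(1)] elim(1) by (simp add: s_def)
    qed
  qed
qed

text \<open>The factor found by the previous lemma depends on \<open>a < 1\<close>. Since gaps decrease in time, it suffices
  to use the value \<open>a = b k\<close>, tending to \<open>1\<close>, for the \<open>k\<close>-th member of the subfamily.\<close>

lemma product_cutoff_imp_subfamily_cutoff:
  assumes cutoff: "has_cutoff_time G u"
  shows "some_subfamily_has_cutoff g"
proof -
  have u: "\<And>n. 1 \<le> n \<Longrightarrow> 0 < u n" and sub: "\<And>a. 1 < a \<Longrightarrow> (\<lambda>n. G n (a * u n)) \<longlonglongrightarrow> 0"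
    and sup: "\<And>a. 0 < a \<Longrightarrow> a < 1 \<Longrightarrow> (\<lambda>n. G n (a * u n)) \<longlonglongrightarrow> 1"
    using cutoff by (auto simp: has_cutoff_time_def)
  have "(\<lambda>n. g n (2 * u n)) \<longlonglongrightarrow> 0"
  proof (rule tendsto_sandwich[OF _ _ tendsto_const sub])
    show "eventually (\<lambda>n. 0 \<le> g n (2 * u n)) sequentially"
      by (rule eventually_sequentiallyI[of 1]) (use g_bounds u in auto)
    show "eventually (\<lambda>n. g n (2 * u n) \<le> G n (2 * u n)) sequentially"
      by (rule eventually_sequentiallyI[of 1]) (use factor_le u in auto)
  qed auto
  then have E_le: "eventually (\<lambda>n. E n \<le> 2 * u n) sequentially"
    by (rule eventually_E_le[rotated]) (use u in auto)
  have "(\<lambda>m. 4 * L * c * \<rho> ^ m / (1 - \<rho>)) \<longlonglongrightarrow> 4 * L * c * 0 / (1 - \<rho>)"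
    by (intro tendsto_intros LIMSEQ_realpow_zero) (use \<rho> in auto)
  then have "eventually (\<lambda>m. 4 * L * c * \<rho> ^ m / (1 - \<rho>) < 1 / 2) sequentially"
    by (rule order_tendstoD) simp
  then obtain m where m: "4 * L * c * \<rho> ^ m / (1 - \<rho>) \<le> 1 / 2"
    by (meson eventually_happens' less_imp_le trivial_limit_sequentially)
  define b where "b k = 1 - 1 / real (k + 2)" for k
  have b: "1 / 2 \<le> b k" "b k < 1" for k by (auto simp: b_def field_simps)
  define P where "P k p = (1 \<le> snd p \<and> snd p \<le> fst p \<and> b k < g (snd p) (b k * u (fst p)))"
    for k and p :: "nat \<times> nat"
  have late: "\<exists>p. P k p \<and> N < snd p" for k N
  proof -
    have "eventually (\<lambda>n. \<exists>i. 1 \<le> i \<and> i \<le> n \<and> n \<le> i + m \<and> b k < g i (b k * u n)) sequentially"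
      by (rule product_cutoff_yields_late_factor[OF u E_le m b(1) sup b(2)])
         (use b[of k] in auto)
    with eventually_gt_at_top[of "N + m"]
    have "eventually (\<lambda>n. \<exists>i. P k (n, i) \<and> N < i) sequentially"
    proof eventually_elim
      case (elim n)
      then obtain i where "1 \<le> i" "i \<le> n" "n \<le> i + m" "b k < g i (b k * u n)" by blast
      with elim(1) show ?case by (intro exI[of _ i]) (auto simp: P_def)
    qed
    then show ?thesis using eventually_happens'[OF trivial_limit_sequentially] by fastforce
  qed
  have "\<exists>f. \<forall>k. P k (f k) \<and> fst (f k) < snd (f (Suc k))"
    by (rule dependent_nat_choice) (use late in blast)+
  then obtain f where f: "\<And>k. P k (f k)" "\<And>k. fst (f k) < snd (f (Suc k))" by blast
  define \<xi> \<nu> where "\<xi> k = snd (f k)" and "\<nu> k = fst (f k)" for k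
  have \<xi>: "1 \<le> \<xi> k" "\<xi> k \<le> \<nu> k" "\<nu> k < \<xi> (Suc k)" "b k < g (\<xi> k) (b k * u (\<nu> k))" for k
    using f[of k] by (auto simp: P_def \<xi>_def \<nu>_def)
  have smono: "strict_mono \<xi>" "strict_mono \<nu>"
    unfolding strict_mono_Suc_iff using \<xi> le_less_trans less_le_trans by blast+
  have u\<nu>: "0 < u (\<nu> k)" for k using u \<xi>(1,2) order_trans by blast
  have "has_cutoff_time (\<lambda>k. g (\<xi> k)) (\<lambda>k. u (\<nu> k))"
    unfolding has_cutoff_time_def
  proof (intro conjI allI impI)
    fix a :: real assume a: "1 < a"
    show "(\<lambda>k. g (\<xi> k) (a * u (\<nu> k))) \<longlonglongrightarrow> 0"
    proof (rule tendsto_sandwich[OF _ _ tendsto_const LIMSEQ_subseq_LIMSEQ[OF sub[OF a] smono(2), unfolded o_def]])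
      show "eventually (\<lambda>k. 0 \<le> g (\<xi> k) (a * u (\<nu> k))) sequentially"
        using g_bounds[OF \<xi>(1)] u\<nu> a by simp
      show "eventually (\<lambda>k. g (\<xi> k) (a * u (\<nu> k)) \<le> G (\<nu> k) (a * u (\<nu> k))) sequentially"
        using factor_le[OF \<xi>(1,2)] u\<nu> a by simp
    qed
  next
    fix a :: real assume a: "0 < a \<and> a < 1"
    have b_lim: "b \<longlonglongrightarrow> 1"
      unfolding b_def using tendsto_diff[OF tendsto_const LIMSEQ_ignore_initial_segment[OF lim_1_over_n, of 2], of 1]
      by simp
    show "(\<lambda>k. g (\<xi> k) (a * u (\<nu> k))) \<longlonglongrightarrow> 1"
    proof (rule tendsto_sandwich[OF _ _ b_lim tendsto_const])
      show "eventually (\<lambda>k. g (\<xi> k) (a * u (\<nu> k)) \<le> 1) sequentially"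
        using g_bounds[OF \<xi>(1)] u\<nu> a by simp
      show "eventually (\<lambda>k. b k \<le> g (\<xi> k) (a * u (\<nu> k))) sequentially"
        using order_tendstoD(1)[OF b_lim conjunct2[OF a]]
      proof eventually_elim
        case (elim k)
        have "g (\<xi> k) (b k * u (\<nu> k)) \<le> g (\<xi> k) (a * u (\<nu> k))"
          by (rule g_antimono[OF \<xi>(1)]) (use elim a u\<nu>[of k] in auto)
        then show ?case using \<xi>(4)[of k] by linarith
      qed
    qed
  qed (use u\<nu> in auto)
  then show ?thesis
    unfolding some_subfamily_has_cutoff_def has_cutoff_def
    using smono(1) \<xi>(1) by (intro exI[of _ \<xi>]) (auto simp: strict_mono_on_def strict_mono_def)
qed

end

section \<open>From mixing times to the common time scale\<close>

lemma has_cutoff_time_cong: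
  assumes "\<And>n s. 1 \<le> n \<Longrightarrow> 0 < s \<Longrightarrow> d n s = d' n s" and "\<And>n. 1 \<le> n \<Longrightarrow> t n = t' n"
  shows "has_cutoff_time d t \<longleftrightarrow> has_cutoff_time d' t'"
proof -
  have "(\<lambda>n. d n (a * t n)) \<longlonglongrightarrow> l \<longleftrightarrow> (\<lambda>n. d' n (a * t' n)) \<longlonglongrightarrow> l"
    if "\<forall>n\<ge>1. 0 < t n" "0 < a" for a l
    by (rule tendsto_cong, rule eventually_sequentiallyI[of 1]) (use assms that in auto)
  then show ?thesis
    unfolding has_cutoff_time_def using assms(2) by (smt (verit, ccfv_SIG))
qed

lemma has_cutoff_time_rescale:
  assumes "\<And>n. 1 \<le> n \<Longrightarrow> 0 < p n"
  shows "has_cutoff_time d t \<longleftrightarrow> has_cutoff_time (\<lambda>n s. d n (p n * s)) (\<lambda>n. t n / p n)"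
proof -
  have "(\<lambda>n. d n (a * t n)) \<longlonglongrightarrow> l \<longleftrightarrow> (\<lambda>n. d n (p n * (a * (t n / p n)))) \<longlonglongrightarrow> l" for a l
    by (rule tendsto_cong, rule eventually_sequentiallyI[of 1]) (use assms in force)
  moreover have "(\<forall>n\<ge>1. 0 < t n) \<longleftrightarrow> (\<forall>n\<ge>1. 0 < t n / p n)"
    using assms by (metis zero_less_divide_iff order.asym)
  ultimately show ?thesis by (simp add: has_cutoff_time_def)
qed

lemma has_cutoff_time_sqrt:
  assumes "\<And>n s. 1 \<le> n \<Longrightarrow> 0 < s \<Longrightarrow> 0 \<le> h n s"
  shows "has_cutoff_time (\<lambda>n s. sqrt (h n s)) t \<longleftrightarrow> has_cutoff_time h t"
proof -
  have "(\<lambda>n. sqrt (h n (a * t n))) \<longlonglongrightarrow> l \<longleftrightarrow> (\<lambda>n. h n (a * t n)) \<longlonglongrightarrow> l"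
    if t: "\<forall>n\<ge>1. 0 < t n" and a: "0 < a" and l: "l = 0 \<or> l = 1" for a l
  proof
    assume "(\<lambda>n. sqrt (h n (a * t n))) \<longlonglongrightarrow> l"
    then have "(\<lambda>n. (sqrt (h n (a * t n)))\<^sup>2) \<longlonglongrightarrow> l\<^sup>2" by (rule tendsto_power)
    moreover have "eventually (\<lambda>n. (sqrt (h n (a * t n)))\<^sup>2 = h n (a * t n)) sequentially"
      by (rule eventually_sequentiallyI[of 1]) (use assms t a in auto)
    ultimately show "(\<lambda>n. h n (a * t n)) \<longlonglongrightarrow> l" using l by (auto simp: tendsto_cong)
  next
    assume "(\<lambda>n. h n (a * t n)) \<longlonglongrightarrow> l"
    then have "(\<lambda>n. sqrt (h n (a * t n))) \<longlonglongrightarrow> sqrt l" by (rule tendsto_real_sqrt)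
    then show "(\<lambda>n. sqrt (h n (a * t n))) \<longlonglongrightarrow> l" using l by auto
  qed
  then show ?thesis unfolding has_cutoff_time_def by (smt (verit, ccfv_SIG))
qed

text \<open>The function \<open>f\<close> turns gaps into distances: it is the identity for total variation and the square root
  for the Hellinger distance.\<close>

lemma (in rescaled_family) product_cutoff_of_rescaled:
  assumes f: "\<And>h t. (\<And>n s. 1 \<le> n \<Longrightarrow> 0 < s \<Longrightarrow> 0 \<le> h n s) \<Longrightarrow>
      has_cutoff_time (\<lambda>n s. f (h n s)) t \<longleftrightarrow> has_cutoff_time h t"
    and p: "\<And>n. 1 \<le> n \<Longrightarrow> 0 < p n" and q: "\<And>n. 1 \<le> n \<Longrightarrow> 0 < q n"
    and d: "\<And>n s. 1 \<le> n \<Longrightarrow> 0 < s \<Longrightarrow> d n (p n * s) = f (g n s)"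
    and D: "\<And>n s. 1 \<le> n \<Longrightarrow> 0 < s \<Longrightarrow> D n (q n * s) = f (G n s)"
  shows "(\<forall>t. has_cutoff_time d t \<longrightarrow> has_cutoff_time D (\<lambda>n. q n * t n / p n)) \<and>
    (\<not> some_subfamily_has_cutoff d \<longrightarrow> \<not> has_cutoff D)"
proof (intro conjI allI impI)
  have D_iff: "has_cutoff_time D t \<longleftrightarrow> has_cutoff_time G (\<lambda>n. t n / q n)" for t
  proof -
    have "has_cutoff_time D t \<longleftrightarrow> has_cutoff_time (\<lambda>n s. D n (q n * s)) (\<lambda>n. t n / q n)"
      by (rule has_cutoff_time_rescale[OF q])
    also have "\<dots> \<longleftrightarrow> has_cutoff_time (\<lambda>n s. f (G n s)) (\<lambda>n. t n / q n)"
      by (rule has_cutoff_time_cong[OF D refl])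
    also have "\<dots> \<longleftrightarrow> has_cutoff_time G (\<lambda>n. t n / q n)" by (rule f) (rule G_bounds)
    finally show ?thesis .
  qed
  have d_iff: "has_cutoff_time d t \<longleftrightarrow> has_cutoff_time g (\<lambda>n. t n / p n)" for t
  proof -
    have "has_cutoff_time d t \<longleftrightarrow> has_cutoff_time (\<lambda>n s. d n (p n * s)) (\<lambda>n. t n / p n)"
      by (rule has_cutoff_time_rescale[OF p])
    also have "\<dots> \<longleftrightarrow> has_cutoff_time (\<lambda>n s. f (g n s)) (\<lambda>n. t n / p n)"
      by (rule has_cutoff_time_cong[OF d refl])
    also have "\<dots> \<longleftrightarrow> has_cutoff_time g (\<lambda>n. t n / p n)" by (rule f) (use g_bounds in blast)
    finally show ?thesis .
  qed
  {
    fix t assume "has_cutoff_time d t"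
    then have "has_cutoff_time g (\<lambda>n. t n / p n)" by (simp only: d_iff)
    then have "has_cutoff_time G (\<lambda>n. t n / p n)" by (rule cutoff_transfers_to_products)
    moreover have "t n / p n = (q n * t n / p n) / q n" if "1 \<le> n" for n using q[OF that] by simp
    ultimately have "has_cutoff_time G (\<lambda>n. (q n * t n / p n) / q n)"
      using has_cutoff_time_cong[of G G "\<lambda>n. t n / p n" "\<lambda>n. (q n * t n / p n) / q n"] by blast
    then show "has_cutoff_time D (\<lambda>n. q n * t n / p n)" by (simp only: D_iff)
  }
  assume none: "\<not> some_subfamily_has_cutoff d"
  show "\<not> has_cutoff D"
  proof
    assume "has_cutoff D"
    then obtain t where "has_cutoff_time G (\<lambda>n. t n / q n)" by (auto simp: has_cutoff_def D_iff)
    then have "some_subfamily_has_cutoff g" by (rule product_cutoff_imp_subfamily_cutoff)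
    then obtain \<xi> u where \<xi>: "strict_mono_on {1..} \<xi>" "\<forall>n\<ge>1. 1 \<le> \<xi> n"
      and u: "has_cutoff_time (\<lambda>n. g (\<xi> n)) u"
      by (auto simp: some_subfamily_has_cutoff_def has_cutoff_def)
    have "has_cutoff_time (\<lambda>n s. f (g (\<xi> n) s)) u"
      by (rule f[THEN iffD2, OF _ u]) (use g_bounds \<xi>(2) in blast)
    moreover have "d (\<xi> n) (p (\<xi> n) * s) = f (g (\<xi> n) s)" if "1 \<le> n" "0 < s" for n s
      using d that \<xi>(2) by blast
    moreover have "p (\<xi> n) * u n / p (\<xi> n) = u n" if "1 \<le> n" for n
      using p[of "\<xi> n"] \<xi>(2) that by simp
    ultimately have "has_cutoff_time (\<lambda>n s. d (\<xi> n) (p (\<xi> n) * s)) (\<lambda>n. p (\<xi> n) * u n / p (\<xi> n))"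
      using has_cutoff_time_cong[of "\<lambda>n s. d (\<xi> n) (p (\<xi> n) * s)" "\<lambda>n s. f (g (\<xi> n) s)"
          "\<lambda>n. p (\<xi> n) * u n / p (\<xi> n)" u] by blast
    then have "has_cutoff_time (\<lambda>n. d (\<xi> n)) (\<lambda>n. p (\<xi> n) * u n)"
      using has_cutoff_time_rescale[of "\<lambda>n. p (\<xi> n)" "\<lambda>n. d (\<xi> n)" "\<lambda>n. p (\<xi> n) * u n"] p \<xi>(2) by blast
    with none \<xi> show False by (auto simp: some_subfamily_has_cutoff_def has_cutoff_def)
  qed
qed

lemma real_mixing_time:
  assumes "0 < mixing_time d \<epsilon>" "mixing_time d \<epsilon> < \<infinity>"
  defines "T \<equiv> real_of_ereal (mixing_time d \<epsilon>)"
  shows "0 < T" and "0 \<le> s \<Longrightarrow> s < T \<Longrightarrow> \<epsilon> < d s"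
    and "T < s \<Longrightarrow> \<exists>t. 0 \<le> t \<and> t < s \<and> d t \<le> \<epsilon>"
proof -
  have T: "mixing_time d \<epsilon> = ereal T" using assms by (cases "mixing_time d \<epsilon>") auto
  show "0 < T" using assms(1) T by simp
  show "\<epsilon> < d s" if "0 \<le> s" "s < T"
  proof (rule ccontr)
    assume "\<not> ?thesis"
    then have "mixing_time d \<epsilon> \<le> ereal s"
      unfolding mixing_time_def by (intro INF_lower) (use that in auto)
    then show False using that T by simp
  qed
  show "\<exists>t. 0 \<le> t \<and> t < s \<and> d t \<le> \<epsilon>" if "T < s"
  proof -
    have "mixing_time d \<epsilon> < ereal s" using T that by simp
    then show ?thesis unfolding mixing_time_def INF_less_iff by auto
  qed
qed

text \<open>Between \<open>i\<close> and \<open>n\<close> the term \<open>A n * n\<close> grows at least linearly up to a bounded error in both cases of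
  the first condition, the monotone \<open>B\<close> helps, and the bounded \<open>C\<close> costs a constant factor.\<close>

lemma geometric_growth:
  assumes decomp: "\<And>n. 1 \<le> n \<Longrightarrow> D n = A n * real n + B n + C n"
    and I: "condition_I A" and II: "condition_II B C D"
  obtains c \<rho> where "0 < c" "0 < \<rho>" "\<rho> < 1"
    "\<And>i n. 1 \<le> i \<Longrightarrow> i \<le> n \<Longrightarrow> exp (D i) \<le> c * \<rho> ^ (n - i) * exp (D n)"
proof -
  have B: "B i \<le> B n" if "1 \<le> i" "i \<le> n" for i n
    using II that by (auto simp: condition_II_def mono_on_def)
  obtain \<gamma> where \<gamma>: "\<bar>C n\<bar> \<le> \<gamma>" if "1 \<le> n" for n
    using II by (force simp: condition_II_def bounded_iff)
  have "\<exists>\<alpha>>0. \<exists>\<kappa>. \<forall>i n. 1 \<le> i \<longrightarrow> i \<le> n \<longrightarrow>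
      \<alpha> * (real n - real i) - \<kappa> \<le> A n * real n - A i * real i"
    using I unfolding condition_I_def
  proof
    assume A: "\<forall>n\<ge>1. 0 < A n \<and> A n \<le> A (Suc n)"
    have mono: "A i \<le> A n" if "1 \<le> i" "i \<le> n" for i n
      using that(2)
    proof (induction n rule: dec_induct)
      case (step k)
      then have "A k \<le> A (Suc k)" using A that(1) by simp
      with step show ?case by linarith
    qed simp
    have "A 1 * (real n - real i) - 0 \<le> A n * real n - A i * real i" if "1 \<le> i" "i \<le> n" for i n
    proof -
      have "A 1 * (real n - real i) \<le> A i * (real n - real i)"
        by (rule mult_right_mono) (use mono that in auto)
      moreover have "A i * real n \<le> A n * real n"
        by (rule mult_right_mono) (use mono that in auto)
      ultimately show ?thesis by (simp add: algebra_simps)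
    qed
    then show ?thesis using A by (metis order_refl)
  next
    assume "\<exists>a>0. bounded ((\<lambda>n. real n * \<bar>A n - a\<bar>) ` {1..})"
    then obtain a M where a: "0 < a" and M: "\<And>n. 1 \<le> n \<Longrightarrow> \<bar>real n * \<bar>A n - a\<bar>\<bar> \<le> M"
      by (auto simp: bounded_iff)
    have M': "\<bar>A n * real n - a * real n\<bar> \<le> M" if "1 \<le> n" for n
      using M[OF that] by (simp add: abs_mult left_diff_distrib[symmetric] mult.commute)
    have "a * (real n - real i) - 2 * M \<le> A n * real n - A i * real i" if "1 \<le> i" "i \<le> n" for i n
      using M'[of n] M'[of i] that by (simp add: algebra_simps abs_le_iff)
    with a show ?thesis by blast
  qed
  then obtain \<alpha> \<kappa> where \<alpha>: "0 < \<alpha>"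
    and A: "\<And>i n. 1 \<le> i \<Longrightarrow> i \<le> n \<Longrightarrow> \<alpha> * (real n - real i) - \<kappa> \<le> A n * real n - A i * real i"
    by blast
  show thesis
  proof (rule that[of "exp (\<kappa> + 2 * \<gamma>)" "exp (- \<alpha>)"])
    fix i n :: nat assume i: "1 \<le> i" "i \<le> n"
    have "D i \<le> (\<kappa> + 2 * \<gamma>) + real (n - i) * (- \<alpha>) + D n"
      using A[OF i] B[OF i] \<gamma>[of i] \<gamma>[of n] decomp[of i] decomp[of n] i
      by (simp add: of_nat_diff algebra_simps abs_le_iff)
    then have "exp (D i) \<le> exp ((\<kappa> + 2 * \<gamma>) + real (n - i) * (- \<alpha>) + D n)" by simp
    also have "\<dots> = exp (\<kappa> + 2 * \<gamma>) * exp (- \<alpha>) ^ (n - i) * exp (D n)"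
      unfolding exp_add exp_of_nat_mult by simp
    finally show "exp (D i) \<le> exp (\<kappa> + 2 * \<gamma>) * exp (- \<alpha>) ^ (n - i) * exp (D n)" .
  qed (use \<alpha> in auto)
qed

lemma product_family_weights:
  fixes p :: "nat \<Rightarrow> real"
  assumes "\<And>n. 1 \<le> n \<Longrightarrow> 0 < p n" and "1 \<le> n"
  shows "0 < (\<Sum>j=1..n. p j)" and "i \<in> {1..n} \<Longrightarrow> 0 \<le> p i / (\<Sum>j=1..n. p j)"
    and "(\<Sum>i=1..n. p i / (\<Sum>j=1..n. p j)) = (1 :: real)"
proof -
  show q: "0 < (\<Sum>j=1..n. p j)" by (rule sum_pos) (use assms(2) in \<open>auto intro!: assms(1)\<close>)
  show "0 \<le> p i / (\<Sum>j=1..n. p j)" if "i \<in> {1..n}"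
    by (rule divide_nonneg_pos[OF _ q]) (use assms(1)[of i] that in auto)
  show "(\<Sum>i=1..n. p i / (\<Sum>j=1..n. p j)) = (1 :: real)"
    using q unfolding sum_divide_distrib[symmetric] by simp
qed

lemma (in overlap) rescaled_family_worst_gap:
  fixes F :: "nat \<Rightarrow> 'a chain"
  assumes M: "\<And>n. 1 \<le> n \<Longrightarrow> stationary_chain (F n)" and p: "\<And>n. 1 \<le> n \<Longrightarrow> 0 < p n"
    and T: "\<And>n. 1 \<le> n \<Longrightarrow> 0 < T n"
    and before: "\<And>n s. 1 \<le> n \<Longrightarrow> 0 \<le> s \<Longrightarrow> s < T n \<Longrightarrow> \<delta> \<le> worst_gap \<phi> (F n) s" and \<delta>: "0 < \<delta>"
    and after: "\<And>n s. 1 \<le> n \<Longrightarrow> T n < s \<Longrightarrow> 2 * worst_gap min (F n) s \<le> r" and r: "0 \<le> r" "r < 1"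
    and le_min: "\<And>n s. 1 \<le> n \<Longrightarrow> 0 \<le> s \<Longrightarrow> worst_gap \<phi> (F n) s \<le> worst_gap min (F n) s"
    and D: "\<And>n. 1 \<le> n \<Longrightarrow> D n = ln (T n / p n)" "\<And>n. 1 \<le> n \<Longrightarrow> D n = A n * real n + B n + C n"
    and I: "condition_I A" and II: "condition_II B C D"
  obtains c \<rho> where "rescaled_family (\<lambda>n s. worst_gap \<phi> (F n) (p n * s))
    (\<lambda>n s. worst_gap \<phi> (product_family p F n) ((\<Sum>i=1..n. p i) * s)) (\<lambda>n. exp (D n)) \<delta> r (2 / (1 - r)) c \<rho>"
proof -
  obtain c \<rho> where c: "0 < c" "0 < \<rho>" "\<rho> < 1"
    "\<And>i n. 1 \<le> i \<Longrightarrow> i \<le> n \<Longrightarrow> exp (D i) \<le> c * \<rho> ^ (n - i) * exp (D n)"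
    using geometric_growth[OF D(2) I II] by blast
  have E: "exp (D n) = T n / p n" if "1 \<le> n" for n using D(1) T p that by simp
  have E_less: "s < exp (D n) \<longleftrightarrow> p n * s < T n" "exp (D n) < s \<longleftrightarrow> T n < p n * s" if "1 \<le> n" for n s
    using p[OF that] by (auto simp: E[OF that] field_simps)
  have product: "i \<in> {1..n} \<Longrightarrow> worst_gap \<phi> (F i) (p i * s) \<le> worst_gap \<phi> (product_family p F n) ((\<Sum>i=1..n. p i) * s)"
    "worst_gap \<phi> (product_family p F n) ((\<Sum>i=1..n. p i) * s) \<le> 1 - (\<Prod>i=1..n. 1 - worst_gap \<phi> (F i) (p i * s))"
    if n: "1 \<le> n" and s: "0 < s" for n i :: nat and s :: real
  proof -
    define q where "q = (\<Sum>i\<in>{1..n}. p i)"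
    note weights = product_family_weights[where p = p, OF p n, folded q_def]
    have Mn: "\<And>i. i \<in> {1..n} \<Longrightarrow> stationary_chain (F i)" using M by simp
    have qs: "0 \<le> q * s" "p i / q * (q * s) = p i * s" for i using weights(1) s by auto
    show "worst_gap \<phi> (product_family p F n) ((\<Sum>i=1..n. p i) * s) \<le> 1 - (\<Prod>i=1..n. 1 - worst_gap \<phi> (F i) (p i * s))"
      unfolding product_family_def q_def[symmetric]
      by (rule worst_gap_product_le[where F = F and w = "\<lambda>i. p i / q" and t = "q * s", unfolded qs(2)])
         (use Mn weights qs(1) in blast)+
    show "worst_gap \<phi> (F i) (p i * s) \<le> worst_gap \<phi> (product_family p F n) ((\<Sum>i=1..n. p i) * s)"
      if "i \<in> {1..n}"
      unfolding product_family_def q_def[symmetric]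
      by (rule worst_gap_factor_le_product[where F = F and w = "\<lambda>i. p i / q" and t = "q * s" and n = n, unfolded qs(2)])
         (use Mn weights qs(1) that in blast)+
  qed
  show thesis
  proof (rule that, unfold_locales)
    fix n :: nat and s :: real assume n: "1 \<le> n" and s: "0 < s"
    have ps: "0 \<le> p n * s" "0 < p n * s" using p[OF n] s by auto
    show "0 \<le> worst_gap \<phi> (F n) (p n * s) \<and> worst_gap \<phi> (F n) (p n * s) \<le> 1"
      using worst_gap_bounds[OF M[OF n] ps(1)] by simp
    show "worst_gap \<phi> (F n) (p n * t) \<le> worst_gap \<phi> (F n) (p n * s)" if "s \<le> t" for t
      by (rule worst_gap_antimono[OF M[OF n] ps(1)]) (use p[OF n] that in simp)
    show "\<delta> \<le> worst_gap \<phi> (F n) (p n * s)" if "s < exp (D n)"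
      by (rule before[OF n ps(1)]) (use that E_less[OF n] in simp)
    have "worst_gap \<phi> (F n) (p n * s) \<le> worst_gap min (F n) (p n * s)" by (rule le_min[OF n ps(1)])
    also have "\<dots> \<le> 2 / (1 - r) * (T n / (p n * s))"
      by (rule worst_gap_min_decay[OF M[OF n] T[OF n] r after[OF n] ps(2)]) (use T[OF n] in simp)
    finally show "worst_gap \<phi> (F n) (p n * s) \<le> 2 / (1 - r) * (exp (D n) / s)"
      by (simp add: E[OF n])
    show "worst_gap \<phi> (product_family p F n) ((\<Sum>i=1..n. p i) * s)
        \<le> 1 - (\<Prod>i=1..n. 1 - worst_gap \<phi> (F i) (p i * s))"
      by (rule product(2)[OF n s])
  next
    fix i n :: nat and s :: real assume "1 \<le> i" "i \<le> n" "0 < s"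
    then show "worst_gap \<phi> (F i) (p i * s) \<le> worst_gap \<phi> (product_family p F n) ((\<Sum>i=1..n. p i) * s)"
      by (intro product(1)) auto
  next
    fix n :: nat and s :: real assume n: "1 \<le> n" and s: "exp (D n) < s"
    then have s0: "0 < s" using exp_gt_zero less_trans by blast
    then have ps: "0 \<le> p n * s" using p[OF n] by simp
    have "worst_gap \<phi> (F n) (p n * s) \<le> worst_gap min (F n) (p n * s)" by (rule le_min[OF n ps])
    also have "\<dots> \<le> 2 * worst_gap min (F n) (p n * s)" using min.worst_gap_bounds(1)[OF M[OF n] ps] by simp
    also have "\<dots> \<le> r" by (rule after[OF n]) (use s E_less[OF n] in simp)
    finally show "worst_gap \<phi> (F n) (p n * s) \<le> r" .
  next
    obtain N where "mono_on {N..} D" using II by (auto simp: condition_II_def)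
    then show "\<exists>N. \<forall>i n. N \<le> i \<longrightarrow> i \<le> n \<longrightarrow> exp (D i) \<le> exp (D n)"
      by (intro exI[of _ N]) (auto simp: mono_on_def)
  qed (use c \<delta> r in auto)
qed

lemma uniform_bounds_of_INF_SUP:
  fixes \<epsilon> :: "nat \<Rightarrow> real"
  assumes "0 < (INF n\<in>{1..}. ereal (\<epsilon> n))" and "(SUP n\<in>{1..}. ereal (\<epsilon> n)) < ereal b"
  obtains e0 e1 where "0 < e0" "e1 < b" "\<And>n. 1 \<le> n \<Longrightarrow> e0 \<le> \<epsilon> n" "\<And>n. 1 \<le> n \<Longrightarrow> \<epsilon> n \<le> e1"
proof -
  obtain e0 where e0: "0 < ereal e0" "ereal e0 < (INF n\<in>{1..}. ereal (\<epsilon> n))" using ereal_dense2[OF assms(1)] by auto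
  obtain e1 where e1: "(SUP n\<in>{1..}. ereal (\<epsilon> n)) < ereal e1" "ereal e1 < ereal b" using ereal_dense2[OF assms(2)] by auto
  show thesis
  proof (rule that[of e0 e1])
    show "e0 \<le> \<epsilon> n" if "1 \<le> n" for n
      using less_le_trans[OF e0(2) INF_lower[of n "{1..}" "\<lambda>n. ereal (\<epsilon> n)"]] that by simp
    show "\<epsilon> n \<le> e1" if "1 \<le> n" for n
      using le_less_trans[OF SUP_upper[of n "{1..}" "\<lambda>n. ereal (\<epsilon> n)"] e1(1)] that by simp
  qed (use e0 e1 in auto)
qed

lemma stationary_chain_product_family:
  assumes M: "\<And>n. 1 \<le> n \<Longrightarrow> stationary_chain (F n)" and p: "\<And>n. 1 \<le> n \<Longrightarrow> 0 < p n" and n: "1 \<le> n"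
  shows "stationary_chain (product_family p F n)"
  unfolding product_family_def
  by (rule stationary_chain_product_chain) (use M product_family_weights(2,3)[where p = p, OF p n] in auto)

lemma tv_product_cutoff:
  fixes F :: "nat \<Rightarrow> 'a chain"
  assumes M: "\<And>n. 1 \<le> n \<Longrightarrow> stationary_chain (F n)" and p: "\<And>n. 1 \<le> n \<Longrightarrow> 0 < p n"
    and \<epsilon>: "0 < (INF n\<in>{1..}. ereal (\<epsilon> n))" "(SUP n\<in>{1..}. ereal (\<epsilon> n)) < ereal (1 / 2)"
    and decomp: "log_mixing_decomposition (\<lambda>n. tv_dist (F n)) p \<epsilon> D A B C"
    and I: "condition_I A" and II: "condition_II B C D"
  shows "(\<forall>t. has_cutoff_time (\<lambda>n. tv_dist (F n)) t \<longrightarrow>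
           has_cutoff_time (\<lambda>n. tv_dist (product_family p F n)) (\<lambda>n. (\<Sum>i=1..n. p i) * t n / p n)) \<and>
      (\<not> some_subfamily_has_cutoff (\<lambda>n. tv_dist (F n)) \<longrightarrow>
       \<not> has_cutoff (\<lambda>n. tv_dist (product_family p F n)))"
proof -
  have q: "0 < (\<Sum>i=1..n. p i)" if "1 \<le> n" for n
    by (rule product_family_weights(1)) (use p that in auto)
  obtain e0 e1 where e: "0 < e0" "e1 < 1 / 2" "\<And>n. 1 \<le> n \<Longrightarrow> e0 \<le> \<epsilon> n" "\<And>n. 1 \<le> n \<Longrightarrow> \<epsilon> n \<le> e1"
    using uniform_bounds_of_INF_SUP[OF \<epsilon>] by blast
  define T where "T n = real_of_ereal (mixing_time (tv_dist (F n)) (\<epsilon> n))" for n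
  have mt: "0 < mixing_time (tv_dist (F n)) (\<epsilon> n)" "mixing_time (tv_dist (F n)) (\<epsilon> n) < \<infinity>"
    and D: "D n = ln (T n / p n)" "D n = A n * real n + B n + C n" if "1 \<le> n" for n
    using decomp that unfolding log_mixing_decomposition_def T_def by blast+
  have T: "0 < T n" "\<And>s. 0 \<le> s \<Longrightarrow> s < T n \<Longrightarrow> \<epsilon> n < tv_dist (F n) s"
    "\<And>s. T n < s \<Longrightarrow> \<exists>t. 0 \<le> t \<and> t < s \<and> tv_dist (F n) t \<le> \<epsilon> n" if "1 \<le> n" for n
    using real_mixing_time[OF mt[OF that]] by (simp_all add: T_def)
  have e1: "0 \<le> e1" using e(1) e(3)[of 1] e(4)[of 1] by simp
  obtain c \<rho> where family: "rescaled_family (\<lambda>n s. worst_gap min (F n) (p n * s))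
    (\<lambda>n s. worst_gap min (product_family p F n) ((\<Sum>i=1..n. p i) * s)) (\<lambda>n. exp (D n)) e0 (2 * e1)
    (2 / (1 - 2 * e1)) c \<rho>"
  proof (rule min.rescaled_family_worst_gap[OF M p T(1) _ e(1) _ _ _ order_refl D I II])
    fix n :: nat and s :: real assume n: "1 \<le> n"
    show "e0 \<le> worst_gap min (F n) s" if "0 \<le> s" "s < T n"
      using T(2)[OF n that] e(3)[OF n] tv_dist_eq[OF M[OF n] that(1)] by simp
    show "2 * worst_gap min (F n) s \<le> 2 * e1" if s: "T n < s"
    proof -
      obtain t where t: "0 \<le> t" "t < s" "tv_dist (F n) t \<le> \<epsilon> n" using T(3)[OF n s] by blast
      have "worst_gap min (F n) s \<le> worst_gap min (F n) t"
        by (rule min.worst_gap_antimono[OF M[OF n]]) (use t in auto)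
      then show ?thesis using t(3) e(4)[OF n] tv_dist_eq[OF M[OF n] t(1)] by simp
    qed
  qed (use e e1 in auto)
  then interpret rescaled_family "\<lambda>n s. worst_gap min (F n) (p n * s)"
    "\<lambda>n s. worst_gap min (product_family p F n) ((\<Sum>i=1..n. p i) * s)" "\<lambda>n. exp (D n)" e0 "2 * e1"
    "2 / (1 - 2 * e1)" c \<rho> .
  show ?thesis
  proof (rule product_cutoff_of_rescaled[where f = "\<lambda>z. z", OF refl p q])
    fix n :: nat and s :: real assume n: "1 \<le> n" and s: "0 < s"
    show "tv_dist (F n) (p n * s) = worst_gap min (F n) (p n * s)"
      by (rule tv_dist_eq[OF M[OF n]]) (use p[OF n] s in simp)
    show "tv_dist (product_family p F n) ((\<Sum>i=1..n. p i) * s)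
        = worst_gap min (product_family p F n) ((\<Sum>i=1..n. p i) * s)"
      by (rule tv_dist_eq[OF stationary_chain_product_family[OF M p n]])
         (use less_imp_le[OF mult_pos_pos[OF q[OF n] s]] in blast)+
  qed auto
qed

lemma hellinger_product_cutoff:
  fixes F :: "nat \<Rightarrow> 'a chain"
  assumes M: "\<And>n. 1 \<le> n \<Longrightarrow> stationary_chain (F n)" and p: "\<And>n. 1 \<le> n \<Longrightarrow> 0 < p n"
    and \<epsilon>: "0 < (INF n\<in>{1..}. ereal (\<epsilon> n))" "(SUP n\<in>{1..}. ereal (\<epsilon> n)) < ereal (1 / 4)"
    and decomp: "log_mixing_decomposition (\<lambda>n. hellinger_dist (F n)) p \<epsilon> D A B C"
    and I: "condition_I A" and II: "condition_II B C D"
  shows "(\<forall>t. has_cutoff_time (\<lambda>n. hellinger_dist (F n)) t \<longrightarrow>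
           has_cutoff_time (\<lambda>n. hellinger_dist (product_family p F n)) (\<lambda>n. (\<Sum>i=1..n. p i) * t n / p n)) \<and>
      (\<not> some_subfamily_has_cutoff (\<lambda>n. hellinger_dist (F n)) \<longrightarrow>
       \<not> has_cutoff (\<lambda>n. hellinger_dist (product_family p F n)))"
proof -
  have q: "0 < (\<Sum>i=1..n. p i)" if "1 \<le> n" for n
    by (rule product_family_weights(1)) (use p that in auto)
  obtain e0 e1 where e: "0 < e0" "e1 < 1 / 4" "\<And>n. 1 \<le> n \<Longrightarrow> e0 \<le> \<epsilon> n" "\<And>n. 1 \<le> n \<Longrightarrow> \<epsilon> n \<le> e1"
    using uniform_bounds_of_INF_SUP[OF \<epsilon>] by blast
  define T where "T n = real_of_ereal (mixing_time (hellinger_dist (F n)) (\<epsilon> n))" for n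
  have mt: "0 < mixing_time (hellinger_dist (F n)) (\<epsilon> n)" "mixing_time (hellinger_dist (F n)) (\<epsilon> n) < \<infinity>"
    and D: "D n = ln (T n / p n)" "D n = A n * real n + B n + C n" if "1 \<le> n" for n
    using decomp that unfolding log_mixing_decomposition_def T_def by blast+
  have T: "0 < T n" "\<And>s. 0 \<le> s \<Longrightarrow> s < T n \<Longrightarrow> \<epsilon> n < hellinger_dist (F n) s"
    "\<And>s. T n < s \<Longrightarrow> \<exists>t. 0 \<le> t \<and> t < s \<and> hellinger_dist (F n) t \<le> \<epsilon> n" if "1 \<le> n" for n
    using real_mixing_time[OF mt[OF that]] by (simp_all add: T_def)
  obtain c \<rho> where family: "rescaled_family (\<lambda>n s. worst_gap geo_mean (F n) (p n * s))
    (\<lambda>n s. worst_gap geo_mean (product_family p F n) ((\<Sum>i=1..n. p i) * s)) (\<lambda>n. exp (D n)) (e0\<^sup>2) (17 / 24)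
    (2 / (1 - 17 / 24)) c \<rho>"
  proof (rule geo_mean.rescaled_family_worst_gap[OF M p T(1) _ _ _ _ _ worst_gap_geo_mean_le_min[OF M] D I II])
    fix n :: nat and s :: real assume n: "1 \<le> n"
    show "e0\<^sup>2 \<le> worst_gap geo_mean (F n) s" if "0 \<le> s" "s < T n"
    proof -
      have "e0 \<le> sqrt (worst_gap geo_mean (F n) s)"
        using T(2)[OF n that] e(3)[OF n] hellinger_dist_eq[OF M[OF n] that(1)] by simp
      then have "e0\<^sup>2 \<le> (sqrt (worst_gap geo_mean (F n) s))\<^sup>2" by (rule power_mono) (use e in simp)
      then show ?thesis using geo_mean.worst_gap_bounds(1)[OF M[OF n] that(1)] by simp
    qed
    show "2 * worst_gap min (F n) s \<le> 17 / 24" if s: "T n < s"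
    proof -
      obtain t where t: "0 \<le> t" "t < s" "hellinger_dist (F n) t \<le> \<epsilon> n" using T(3)[OF n s] by blast
      have "sqrt (worst_gap geo_mean (F n) t) \<le> 1 / 4"
        using t(3) e(2) e(4)[OF n] hellinger_dist_eq[OF M[OF n] t(1)] by simp
      then have "(sqrt (worst_gap geo_mean (F n) t))\<^sup>2 \<le> (1 / 4)\<^sup>2"
        by (rule power_mono) (use geo_mean.worst_gap_bounds(1)[OF M[OF n] t(1)] in simp)
      then have "worst_gap geo_mean (F n) t \<le> 1 / 16"
        using geo_mean.worst_gap_bounds(1)[OF M[OF n] t(1)] by (simp add: power2_eq_square)
      moreover have "worst_gap min (F n) s \<le> worst_gap min (F n) t"
        by (rule min.worst_gap_antimono[OF M[OF n]]) (use t in auto)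
      ultimately show ?thesis using worst_gap_min_le_geo_mean[OF M[OF n] t(1)] by linarith
    qed
  qed (use e in auto)
  then interpret rescaled_family "\<lambda>n s. worst_gap geo_mean (F n) (p n * s)"
    "\<lambda>n s. worst_gap geo_mean (product_family p F n) ((\<Sum>i=1..n. p i) * s)" "\<lambda>n. exp (D n)" "e0\<^sup>2" "17 / 24"
    "2 / (1 - 17 / 24)" c \<rho> .
  show ?thesis
  proof (rule product_cutoff_of_rescaled[where f = sqrt, OF has_cutoff_time_sqrt p q])
    fix n :: nat and s :: real assume n: "1 \<le> n" and s: "0 < s"
    show "hellinger_dist (F n) (p n * s) = sqrt (worst_gap geo_mean (F n) (p n * s))"
      by (rule hellinger_dist_eq[OF M[OF n]]) (use p[OF n] s in simp)
    show "hellinger_dist (product_family p F n) ((\<Sum>i=1..n. p i) * s)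
        = sqrt (worst_gap geo_mean (product_family p F n) ((\<Sum>i=1..n. p i) * s))"
      by (rule hellinger_dist_eq[OF stationary_chain_product_family[OF M p n]])
         (use less_imp_le[OF mult_pos_pos[OF q[OF n] s]] in blast)+
  qed auto
qed

theorem theorem1p3:
  fixes F :: "nat \<Rightarrow> 'a chain"
    and p \<epsilon> A B C D :: "nat \<Rightarrow> real"
  assumes chains: "\<forall>n\<ge>1. irreducible_chain (F n)"
    and p_pos: "\<forall>n\<ge>1. 0 < p n"
  shows
    "(0 < (INF n\<in>{1..}. ereal (\<epsilon> n)) \<and> (SUP n\<in>{1..}. ereal (\<epsilon> n)) < ereal (1 / 2) \<and>
      log_mixing_decomposition (\<lambda>n. tv_dist (F n)) p \<epsilon> D A B C \<and>
      condition_I A \<and> condition_II B C D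
      \<longrightarrow>
      (\<forall>t. has_cutoff_time (\<lambda>n. tv_dist (F n)) t \<longrightarrow>
           has_cutoff_time (\<lambda>n. tv_dist (product_family p F n))
             (\<lambda>n. (\<Sum>i=1..n. p i) * t n / p n)) \<and>
      (\<not> some_subfamily_has_cutoff (\<lambda>n. tv_dist (F n)) \<longrightarrow>
       \<not> has_cutoff (\<lambda>n. tv_dist (product_family p F n))))
     \<and>
     (0 < (INF n\<in>{1..}. ereal (\<epsilon> n)) \<and> (SUP n\<in>{1..}. ereal (\<epsilon> n)) < ereal (1 / 4) \<and>
      log_mixing_decomposition (\<lambda>n. hellinger_dist (F n)) p \<epsilon> D A B C \<and>
      condition_I A \<and> condition_II B C D
      \<longrightarrow>
      (\<forall>t. has_cutoff_time (\<lambda>n. hellinger_dist (F n)) t \<longrightarrow>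
           has_cutoff_time (\<lambda>n. hellinger_dist (product_family p F n))
             (\<lambda>n. (\<Sum>i=1..n. p i) * t n / p n)) \<and>
      (\<not> some_subfamily_has_cutoff (\<lambda>n. hellinger_dist (F n)) \<longrightarrow>
       \<not> has_cutoff (\<lambda>n. hellinger_dist (product_family p F n))))"
proof -
  have M: "\<And>n. 1 \<le> n \<Longrightarrow> stationary_chain (F n)" and p: "\<And>n. 1 \<le> n \<Longrightarrow> 0 < p n"
    using chains p_pos by (auto intro: irreducible_chain_imp_stationary_chain)
  show ?thesis
    by (intro conjI impI; elim conjE; rule tv_product_cutoff[OF M p, THEN conjunct1]
          tv_product_cutoff[OF M p, THEN conjunct2, rule_format]
          hellinger_product_cutoff[OF M p, THEN conjunct1]
          hellinger_product_cutoff[OF M p, THEN conjunct2, rule_format]; assumption)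
qed

end
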